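(* Let $\Omega\subseteq\mathbb{R}^N$, $N\ge 2$, be a bounded domain with Lipschitz boundary, let $p,q\in C_+(\overline\Omega)$ with $p(x)\le q(x)$ for all $x\in\overline\Omega$, and let $0\le\mu\in L^1(\Omega)$. Then the functional $I:W^{1,\mathcal{H}_{\log}}_0(\Omega)\to\mathbb{R}$, $$I(u)=\int_\Omega\Big(\frac{|\nabla u|^{p(x)}}{p(x)}+\mu(x)\frac{|\nabla u|^{q(x)}}{q(x)}\log(e+|\nabla u|)\Big)dx,$$ is of class $C^1$ with $I'(u)=A(u)$, where $A:W^{1,\mathcal{H}_{\log}}_0(\Omega)\to[W^{1,\mathcal{H}_{\log}}_0(\Omega)]^*$ is given for $u,v\in W^{1,\mathcal{H}_{\log}}_0(\Omega)$ by $$\langle A(u),v\rangle=\int_\Omega|\nabla u|^{p(x)-2}\nabla u\cdot\nabla v\,dx+\int_\Omega\mu(x)\Big[\log(e+|\nabla u|)+\frac{|\nabla u|}{q(x)(e+|\nabla u|)}\Big]|\nabla u|^{q(x)-2}\nabla u\cdot\nabla v\,dx.$$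
   Context: $C_+(\overline\Omega)$ is the set of $r\in C(\overline\Omega)$ with $\min_{\overline\Omega}r>1$. $\langle\cdot,\cdot\rangle$ is the duality pairing; $|\xi|^{r-2}\xi$ is read as $0$ at $\xi=0$. Let $\mathcal{H}_{\log}(x,t)=t^{p(x)}+\mu(x)t^{q(x)}\log(e+t)$ for $x\in\overline\Omega$, $t\ge0$. For measurable $u$ set $\varrho_{\mathcal{H}_{\log}}(u)=\int_\Omega\mathcal{H}_{\log}(x,|u|)\,dx$; $L^{\mathcal{H}_{\log}}(\Omega)$ is the space of measurable $u:\Omega\to\mathbb{R}$ with $\varrho_{\mathcal{H}_{\log}}(u)<\infty$. $W^{1,\mathcal{H}_{\log}}(\Omega)=\{u\in L^{\mathcal{H}_{\log}}(\Omega): |\nabla u|\in L^{\mathcal{H}_{\log}}(\Omega)\}$ with norm $\|u\|_{1,\mathcal{H}_{\log}}=\inf\{\lambda>0:\varrho_{\mathcal{H}_{\log}}(u/\lambda)+\varrho_{\mathcal{H}_{\log}}(|\nabla u|/\lambda)\le1\}$, and $W^{1,\mathcal{H}_{\log}}_0(\Omega)$ is the closure of $C_0^\infty(\Omega)$ in it. *)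

theory Defs
  imports "HOL-Analysis.Analysis"
begin

text \<open>The dimension is \<open>DIM('a)\<close>. Elements of function spaces are represented by functions
  \<open>'a \<Rightarrow> real\<close>, without passing to a.e. equivalence classes; values outside the
  domain are irrelevant, since every integral is over \<open>lebesgue_on \<Omega>\<close>. Consequently the
  norm of the Sobolev space below is a seminorm on representatives.\<close>

section \<open>Domains and exponents\<close>

text \<open>Near each boundary point \<open>\<Omega>\<close> is the strict epigraph, in some unit direction \<open>e\<close>, of a
  Lipschitz function \<open>\<gamma>\<close> on the hyperplane orthogonal to \<open>e\<close>.\<close>

definition lipschitz_boundary :: "'a::euclidean_space set \<Rightarrow> bool" where
  "lipschitz_boundary \<Omega> \<longleftrightarrow>
    (\<forall>z\<in>frontier \<Omega>. \<exists>e r L. \<exists>\<gamma> :: 'a \<Rightarrow> real.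
       norm e = 1 \<and> 0 < r \<and> L-lipschitz_on {y. y \<bullet> e = 0} \<gamma> \<and>
       \<Omega> \<inter> ball z r = {x \<in> ball z r. \<gamma> (x - (x \<bullet> e) *\<^sub>R e) < x \<bullet> e})"

definition bounded_lipschitz_domain :: "'a::euclidean_space set \<Rightarrow> bool" where
  "bounded_lipschitz_domain \<Omega> \<longleftrightarrow>
    open \<Omega> \<and> connected \<Omega> \<and> \<Omega> \<noteq> {} \<and> bounded \<Omega> \<and> lipschitz_boundary \<Omega>"

text \<open>For bounded nonempty \<open>\<Omega>\<close> the infimum is attained, i.e. it is the minimum.\<close>

definition C_plus :: "'a::euclidean_space set \<Rightarrow> ('a \<Rightarrow> real) set" where
  "C_plus \<Omega> = {r. continuous_on (closure \<Omega>) r \<and> 1 < (INF x\<in>closure \<Omega>. r x)}"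

section \<open>Test functions and weak gradients\<close>

primrec Ck :: "nat \<Rightarrow> ('a::euclidean_space \<Rightarrow> real) \<Rightarrow> bool" where
  "Ck 0 f \<longleftrightarrow> continuous_on UNIV f"
| "Ck (Suc k) f \<longleftrightarrow> f differentiable_on UNIV \<and>
     (\<forall>i\<in>Basis. Ck k (\<lambda>x. frechet_derivative f (at x) i))"

text \<open>Functions of \<open>C\<^sub>0\<^sup>\<infinity>(\<Omega>)\<close> are taken as already extended by zero to the whole space.\<close>

definition test_functions :: "'a::euclidean_space set \<Rightarrow> ('a \<Rightarrow> real) set" where
  "test_functions \<Omega> = {\<phi>. (\<forall>k. Ck k \<phi>) \<and>
     compact (closure {x. \<phi> x \<noteq> 0}) \<and> closure {x. \<phi> x \<noteq> 0} \<subseteq> \<Omega>}"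

definition locally_integrable ::
    "'a::euclidean_space set \<Rightarrow> ('a \<Rightarrow> 'b::euclidean_space) \<Rightarrow> bool" where
  "locally_integrable \<Omega> f \<longleftrightarrow> (\<forall>K. compact K \<and> K \<subseteq> \<Omega> \<longrightarrow> integrable (lebesgue_on K) f)"

definition is_weak_gradient ::
    "'a::euclidean_space set \<Rightarrow> ('a \<Rightarrow> real) \<Rightarrow> ('a \<Rightarrow> 'a) \<Rightarrow> bool" where
  "is_weak_gradient \<Omega> u g \<longleftrightarrow> locally_integrable \<Omega> u \<and> locally_integrable \<Omega> g \<and>
     (\<forall>\<phi>\<in>test_functions \<Omega>. \<forall>i\<in>Basis.
        (LINT x|lebesgue_on \<Omega>. u x * frechet_derivative \<phi> (at x) i)
          = - (LINT x|lebesgue_on \<Omega>. (g x \<bullet> i) * \<phi> x))"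

definition weakly_differentiable :: "'a::euclidean_space set \<Rightarrow> ('a \<Rightarrow> real) \<Rightarrow> bool" where
  "weakly_differentiable \<Omega> u \<longleftrightarrow> (\<exists>g. is_weak_gradient \<Omega> u g)"

text \<open>A chosen version of the weak gradient, which is unique up to null sets in \<open>\<Omega>\<close>.\<close>

definition weak_gradient ::
    "'a::euclidean_space set \<Rightarrow> ('a \<Rightarrow> real) \<Rightarrow> 'a \<Rightarrow> 'a" where
  "weak_gradient \<Omega> u = (SOME g. is_weak_gradient \<Omega> u g)"

section \<open>The logarithmic Musielak--Orlicz--Sobolev space\<close>

definition H_log ::
    "('a \<Rightarrow> real) \<Rightarrow> ('a \<Rightarrow> real) \<Rightarrow> ('a \<Rightarrow> real) \<Rightarrow> 'a \<Rightarrow> real \<Rightarrow> real" where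
  "H_log p q \<mu> x t = t powr p x + \<mu> x * t powr q x * ln (exp 1 + t)"

definition modular :: "'a::euclidean_space set \<Rightarrow> ('a \<Rightarrow> real) \<Rightarrow> ('a \<Rightarrow> real) \<Rightarrow> ('a \<Rightarrow> real)
    \<Rightarrow> ('a \<Rightarrow> real) \<Rightarrow> ennreal" where
  "modular \<Omega> p q \<mu> u = (\<integral>\<^sup>+x. ennreal (H_log p q \<mu> x \<bar>u x\<bar>) \<partial>lebesgue_on \<Omega>)"

definition L_Hlog :: "'a::euclidean_space set \<Rightarrow> ('a \<Rightarrow> real) \<Rightarrow> ('a \<Rightarrow> real) \<Rightarrow> ('a \<Rightarrow> real)
    \<Rightarrow> ('a \<Rightarrow> real) set" where
  "L_Hlog \<Omega> p q \<mu> = {u \<in> borel_measurable (lebesgue_on \<Omega>). modular \<Omega> p q \<mu> u < \<infinity>}"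

definition W1_Hlog :: "'a::euclidean_space set \<Rightarrow> ('a \<Rightarrow> real) \<Rightarrow> ('a \<Rightarrow> real) \<Rightarrow> ('a \<Rightarrow> real)
    \<Rightarrow> ('a \<Rightarrow> real) set" where
  "W1_Hlog \<Omega> p q \<mu> = {u \<in> L_Hlog \<Omega> p q \<mu>. weakly_differentiable \<Omega> u \<and>
     (\<lambda>x. norm (weak_gradient \<Omega> u x)) \<in> L_Hlog \<Omega> p q \<mu>}"

definition norm_W1 :: "'a::euclidean_space set \<Rightarrow> ('a \<Rightarrow> real) \<Rightarrow> ('a \<Rightarrow> real) \<Rightarrow> ('a \<Rightarrow> real)
    \<Rightarrow> ('a \<Rightarrow> real) \<Rightarrow> real" where
  "norm_W1 \<Omega> p q \<mu> u = Inf {s. 0 < s \<and>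
     modular \<Omega> p q \<mu> (\<lambda>x. u x / s) +
     modular \<Omega> p q \<mu> (\<lambda>x. norm (weak_gradient \<Omega> u x) / s) \<le> 1}"

definition W10_Hlog :: "'a::euclidean_space set \<Rightarrow> ('a \<Rightarrow> real) \<Rightarrow> ('a \<Rightarrow> real) \<Rightarrow> ('a \<Rightarrow> real)
    \<Rightarrow> ('a \<Rightarrow> real) set" where
  "W10_Hlog \<Omega> p q \<mu> = {u \<in> W1_Hlog \<Omega> p q \<mu>.
     \<forall>\<epsilon>>0. \<exists>\<phi>\<in>test_functions \<Omega>. norm_W1 \<Omega> p q \<mu> (\<lambda>x. u x - \<phi> x) < \<epsilon>}"

section \<open>Differential calculus on a space of functions with a (semi)norm\<close>

text \<open>The space depends on the data \<open>(\<Omega>, p, q, \<mu>)\<close> and hence is not a type, so the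
  type-class based Frechet derivative does not apply. Below \<open>V\<close> is a vector space of functions
  and \<open>N\<close> its (semi)norm. A functional that is bounded or Frechet differentiable in the sense
  below depends only on the class of its argument modulo \<open>N\<close>-null elements.\<close>

definition dual_space ::
    "('a \<Rightarrow> real) set \<Rightarrow> (('a \<Rightarrow> real) \<Rightarrow> real) \<Rightarrow> (('a \<Rightarrow> real) \<Rightarrow> real) set" where
  "dual_space V N = {L.
     (\<forall>v\<in>V. \<forall>w\<in>V. L (\<lambda>x. v x + w x) = L v + L w) \<and>
     (\<forall>c. \<forall>v\<in>V. L (\<lambda>x. c * v x) = c * L v) \<and>
     (\<exists>C. \<forall>v\<in>V. \<bar>L v\<bar> \<le> C * N v)}"

definition dual_norm ::
    "('a \<Rightarrow> real) set \<Rightarrow> (('a \<Rightarrow> real) \<Rightarrow> real) \<Rightarrow> (('a \<Rightarrow> real) \<Rightarrow> real) \<Rightarrow> real" where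
  "dual_norm V N L = Sup {\<bar>L v\<bar> |v. v \<in> V \<and> N v \<le> 1}"

definition frechet_derivative_at ::
    "('a \<Rightarrow> real) set \<Rightarrow> (('a \<Rightarrow> real) \<Rightarrow> real) \<Rightarrow> (('a \<Rightarrow> real) \<Rightarrow> real) \<Rightarrow> ('a \<Rightarrow> real)
      \<Rightarrow> (('a \<Rightarrow> real) \<Rightarrow> real) \<Rightarrow> bool" where
  "frechet_derivative_at V N F u L \<longleftrightarrow> L \<in> dual_space V N \<and>
     (\<forall>\<epsilon>>0. \<exists>\<delta>>0. \<forall>h\<in>V. N h < \<delta> \<longrightarrow>
        \<bar>F (\<lambda>x. u x + h x) - F u - L h\<bar> \<le> \<epsilon> * N h)"

definition C1_with_derivative ::
    "('a \<Rightarrow> real) set \<Rightarrow> (('a \<Rightarrow> real) \<Rightarrow> real) \<Rightarrow> (('a \<Rightarrow> real) \<Rightarrow> real)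
      \<Rightarrow> (('a \<Rightarrow> real) \<Rightarrow> ('a \<Rightarrow> real) \<Rightarrow> real) \<Rightarrow> bool" where
  "C1_with_derivative V N F F' \<longleftrightarrow>
     (\<forall>u\<in>V. frechet_derivative_at V N F u (F' u)) \<and>
     (\<forall>u\<in>V. \<forall>\<epsilon>>0. \<exists>\<delta>>0. \<forall>w\<in>V. N (\<lambda>x. w x - u x) < \<delta> \<longrightarrow>
        dual_norm V N (\<lambda>v. F' w v - F' u v) < \<epsilon>)"

section \<open>The energy functional and the operator\<close>

definition energy_density :: "('a \<Rightarrow> real) \<Rightarrow> ('a \<Rightarrow> real) \<Rightarrow> ('a \<Rightarrow> real)
    \<Rightarrow> 'a \<Rightarrow> 'a::euclidean_space \<Rightarrow> real" where
  "energy_density p q \<mu> x \<xi> =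
     norm \<xi> powr p x / p x + \<mu> x * (norm \<xi> powr q x / q x) * ln (exp 1 + norm \<xi>)"

definition energy :: "'a::euclidean_space set \<Rightarrow> ('a \<Rightarrow> real) \<Rightarrow> ('a \<Rightarrow> real) \<Rightarrow> ('a \<Rightarrow> real)
    \<Rightarrow> ('a \<Rightarrow> real) \<Rightarrow> real" where
  "energy \<Omega> p q \<mu> u = (LINT x|lebesgue_on \<Omega>. energy_density p q \<mu> x (weak_gradient \<Omega> u x))"

text \<open>Since \<open>0 powr s = 0\<close> for every \<open>s\<close>, \<open>(norm \<xi> powr (r - 2)) *\<^sub>R \<xi>\<close> is \<open>0\<close> at \<open>\<xi> = 0\<close>.\<close>

definition p_flux :: "('a \<Rightarrow> real) \<Rightarrow> 'a \<Rightarrow> 'a::euclidean_space \<Rightarrow> 'a" where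
  "p_flux p x \<xi> = (norm \<xi> powr (p x - 2)) *\<^sub>R \<xi>"

definition q_log_flux ::
    "('a \<Rightarrow> real) \<Rightarrow> ('a \<Rightarrow> real) \<Rightarrow> 'a \<Rightarrow> 'a::euclidean_space \<Rightarrow> 'a" where
  "q_log_flux q \<mu> x \<xi> =
     (\<mu> x * (ln (exp 1 + norm \<xi>) + norm \<xi> / (q x * (exp 1 + norm \<xi>)))
       * norm \<xi> powr (q x - 2)) *\<^sub>R \<xi>"

definition log_operator :: "'a::euclidean_space set \<Rightarrow> ('a \<Rightarrow> real) \<Rightarrow> ('a \<Rightarrow> real)
    \<Rightarrow> ('a \<Rightarrow> real) \<Rightarrow> ('a \<Rightarrow> real) \<Rightarrow> ('a \<Rightarrow> real) \<Rightarrow> real" where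
  "log_operator \<Omega> p q \<mu> u v =
     (LINT x|lebesgue_on \<Omega>. p_flux p x (weak_gradient \<Omega> u x) \<bullet> weak_gradient \<Omega> v x) +
     (LINT x|lebesgue_on \<Omega>. q_log_flux q \<mu> x (weak_gradient \<Omega> u x) \<bullet> weak_gradient \<Omega> v x)"

end

theory Submission
  imports Defs "HOL-Computational_Algebra.Polynomial"
begin

text \<open>The energy density is \<open>\<Phi>(x, \<xi>) = F(x, |\<xi>|)\<close>, where \<open>F(x, \<cdot>)\<close> is convex with the nondecreasing derivative
\<open>f(x, \<cdot>)\<close> that vanishes at \<open>0\<close>. Hence \<open>\<Phi>(x, \<cdot>)\<close> is convex with gradient \<open>a(x, \<xi>) = f(x, |\<xi>|) \<xi> / |\<xi>|\<close>,
the sum of the two fluxes, and convexity traps the Taylor remainder of the energy: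
\<open>0 \<le> \<Phi>(\<xi> + \<eta>) - \<Phi>(\<xi>) - a(\<xi>) \<bullet> \<eta> \<le> (a(\<xi> + \<eta>) - a(\<xi>)) \<bullet> \<eta>\<close>.
Differentiability and continuity of the derivative therefore follow from one statement, the continuity of
\<open>g \<mapsto> a(\<cdot>, g)\<close> tested against fields \<open>\<zeta>\<close> of modular at most one (\<open>flux_continuity\<close>).

That continuity needs no convergence theorem; it is a pointwise estimate that is integrated once. Since the exponents
lie between constants \<open>1 < \<sigma>\<close> and \<open>K\<close>, dilating the argument changes \<open>f\<close> and \<open>H_log\<close> at most by powers with
exponents independent of \<open>x\<close>. Fix a small \<open>\<tau>\<close>. Where \<open>|\<eta>| < \<tau> |g|\<close>, the difference
\<open>a(g + \<eta>) - a(g)\<close> is a small multiple of \<open>f(|g|)\<close>; elsewhere \<open>|g|\<close> is controlled by \<open>|\<eta>|\<close> and the difference is at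
most a constant times \<open>f(|\<eta>|)\<close> (\<open>flux_oscillation\<close>). A Young inequality with parameter
\<open>k\<close> (\<open>young_radial_flux\<close>) turns products with \<open>|\<zeta>|\<close> into values of \<open>H_log\<close>. Choosing \<open>\<tau>\<close>, then
\<open>k\<close>, then the bound on the modular of \<open>\<eta>\<close> makes every term small. The norm is the gauge of the modular, so
\<open>norm_W1 h < s \<le> 1\<close> gives modular at most \<open>s\<close> for the gradient of \<open>h\<close> and at most one for that gradient divided by \<open>s\<close>.

The remaining point is that the chosen weak gradients depend linearly on the function almost everywhere. This is the
uniqueness of weak gradients, hence the fundamental lemma of the calculus of variations
(\<open>AE_0_if_test_integrals_0\<close>). Products of the functions \<open>exp (- 1 / (n t))\<close> are smooth, supported in a closed
box, and tend to the indicator of its interior; so a function that annihilates all test functions integrates to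
zero over every box.\<close>


section \<open>Smooth bump functions on boxes\<close>

text \<open>A family closed under differentiation that contains \<open>exp (- 1 / t)\<close>, as \<open>P = 1\<close>: the derivative of
\<open>P(1/t) exp (- 1/t)\<close> is \<open>Q(1/t) exp (- 1/t)\<close> with \<open>Q(y) = y\<^sup>2 (P(y) - P'(y))\<close>.\<close>

definition flat_exp :: "real poly \<Rightarrow> real \<Rightarrow> real" where
  "flat_exp P t = (if 0 < t then poly P (1 / t) * exp (- (1 / t)) else 0)"

lemma poly_exp_tendsto_0: "((\<lambda>y. poly P y * exp (- y)) \<longlongrightarrow> (0::real)) at_top"
proof -
  have "((\<lambda>y. \<Sum>i\<le>degree P. coeff P i * (y ^ i / exp y)) \<longlongrightarrow> (\<Sum>i\<le>degree P. coeff P i * 0)) at_top"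
    by (intro tendsto_intros tendsto_power_div_exp_0)
  moreover have "(\<lambda>y. poly P y * exp (- y)) = (\<lambda>y. \<Sum>i\<le>degree P. coeff P i * (y ^ i / exp y))"
    by (simp add: poly_altdef sum_distrib_right exp_minus divide_inverse mult.assoc)
  ultimately show ?thesis by simp
qed

lemma flat_exp_has_derivative:
  "(flat_exp P has_real_derivative flat_exp ([:0, 0, 1:] * (P - pderiv P)) t) (at t)"
proof -
  consider "t > 0" | "t < 0" | "t = 0" by linarith
  then show ?thesis
  proof cases
    case 1
    have "((\<lambda>t. poly P (1 / t) * exp (- (1 / t))) has_real_derivative
        flat_exp ([:0, 0, 1:] * (P - pderiv P)) t) (at t)"
      using 1 by (auto intro!: derivative_eq_intros DERIV_chain'[where g="poly P"] poly_DERIV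
          simp: flat_exp_def field_simps power2_eq_square)
    moreover have "eventually (\<lambda>s. s > 0) (nhds t)"
      using 1 by (simp add: eventually_nhds_in_open eventually_nhds) (metis open_greaterThan greaterThan_iff)
    ultimately show ?thesis
      by (subst DERIV_cong_ev[OF refl _ refl]) (auto elim!: eventually_mono simp: flat_exp_def)
  next
    case 2
    have "((\<lambda>t. 0) has_real_derivative flat_exp ([:0, 0, 1:] * (P - pderiv P)) t) (at t)"
      using 2 by (simp add: flat_exp_def)
    moreover have "eventually (\<lambda>s. s < 0) (nhds t)"
      using 2 by (simp add: eventually_nhds) (metis open_lessThan lessThan_iff)
    ultimately show ?thesis
      by (subst DERIV_cong_ev[OF refl _ refl]) (auto elim!: eventually_mono simp: flat_exp_def)
  next
    case 3
    \<comment> \<open>At the origin \<open>exp (- 1 / s)\<close> decays faster than every polynomial in \<open>1 / s\<close> grows; the quotient adds one more factor \<open>1 / s\<close>.\<close>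
    have "((\<lambda>s. flat_exp P s / s) \<longlongrightarrow> 0) (at_right 0)"
    proof -
      have "((\<lambda>s. poly ([:0, 1:] * P) (1 / s) * exp (- (1 / s))) \<longlongrightarrow> 0) (at_right 0)"
        using filterlim_compose[OF poly_exp_tendsto_0 filterlim_inverse_at_top_right, of "[:0,1:] * P"]
        by (simp add: inverse_eq_divide)
      moreover have "eventually (\<lambda>s::real. s > 0) (at_right 0)"
        by (simp add: eventually_at_right_less)
      ultimately show ?thesis
        by (elim Lim_transform_eventually) (auto elim!: eventually_mono simp: flat_exp_def)
    qed
    moreover have "((\<lambda>s. flat_exp P s / s) \<longlongrightarrow> 0) (at_left 0)"
      by (rule tendsto_eventually) (auto simp: flat_exp_def eventually_at_left_field intro!: exI[of _ "-1"])
    ultimately have "((\<lambda>s. flat_exp P s / s) \<longlongrightarrow> 0) (at 0)"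
      by (simp add: filterlim_at_split)
    then show ?thesis
      using 3 by (simp add: has_field_derivative_iff flat_exp_def)
  qed
qed

lemma frechet_derivative_eqI: "(f has_derivative D) (at x) \<Longrightarrow> frechet_derivative f (at x) = D"
  by (rule frechet_derivative_at[symmetric])

lemma Ck_Suc_if_has_derivative:
  assumes "\<And>x. (f has_derivative D x) (at x)" "\<And>i. i \<in> Basis \<Longrightarrow> Ck k (\<lambda>x. D x i)"
  shows "Ck (Suc k) f"
proof -
  have "frechet_derivative f (at x) = D x" for x
    using assms(1) by (rule frechet_derivative_eqI)
  then show ?thesis
    using assms by (auto simp: differentiable_on_def differentiable_def intro: has_derivative_at_withinI)
qed

lemma Ck_Suc_imp_Ck: "Ck (Suc k) f \<Longrightarrow> Ck k f"
  by (induction k arbitrary: f) (auto simp: differentiable_imp_continuous_on)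

lemma Ck_has_derivative:
  "Ck (Suc k) f \<Longrightarrow> (f has_derivative frechet_derivative f (at x)) (at x)"
  by (auto simp: differentiable_on_def frechet_derivative_works)

lemma Ck_const: "Ck k (\<lambda>x. c)"
proof (induction k arbitrary: c)
  case (Suc k)
  show ?case by (rule Ck_Suc_if_has_derivative[where D="\<lambda>x h. 0"]) (auto intro: Suc)
qed simp

lemma Ck_add: "Ck k f \<Longrightarrow> Ck k g \<Longrightarrow> Ck k (\<lambda>x. f x + g x)"
proof (induction k arbitrary: f g)
  case 0 then show ?case by (auto intro: continuous_intros)
next
  case (Suc k)
  show ?case
    by (rule Ck_Suc_if_has_derivative[OF has_derivative_add[OF Ck_has_derivative[OF Suc.prems(1)] Ck_has_derivative[OF Suc.prems(2)]]])
       (use Suc in auto)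
qed

text \<open>The product rule lowers the order of one factor only, so the other one must be known to be of the lower order too;
this is what \<open>Ck_Suc_imp_Ck\<close> provides.\<close>

lemma Ck_mult: "Ck k f \<Longrightarrow> Ck k g \<Longrightarrow> Ck k (\<lambda>x. f x * g x)"
proof (induction k arbitrary: f g)
  case 0 then show ?case by (auto intro: continuous_intros)
next
  case (Suc k)
  show ?case
    by (rule Ck_Suc_if_has_derivative[OF has_derivative_mult[OF Ck_has_derivative[OF Suc.prems(1)] Ck_has_derivative[OF Suc.prems(2)]]])
       (use Suc Ck_Suc_imp_Ck in \<open>auto intro!: Ck_add Suc.IH simp del: Ck.simps\<close>, auto)
qed

lemma Ck_prod: "(\<And>i. i \<in> I \<Longrightarrow> Ck k (f i)) \<Longrightarrow> Ck k (\<lambda>x. \<Prod>i\<in>I. f i x)"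
  by (induction I rule: infinite_finite_induct) (auto intro: Ck_const Ck_mult)

lemma Ck_flat_exp_affine: "Ck k (\<lambda>x. flat_exp P (x \<bullet> v + c))"
proof (induction k arbitrary: P)
  case 0
  have "continuous_on UNIV (flat_exp P)"
    using flat_exp_has_derivative DERIV_isCont continuous_at_imp_continuous_on by blast
  then show ?case
    by (auto intro!: continuous_on_compose2[of UNIV "flat_exp P"] continuous_intros)
next
  case (Suc k)
  have "((\<lambda>x. flat_exp P (x \<bullet> v + c)) has_derivative
      (\<lambda>h. flat_exp ([:0, 0, 1:] * (P - pderiv P)) (x \<bullet> v + c) * (h \<bullet> v))) (at x)" for x
    by (rule has_derivative_compose[where g = "flat_exp P" and f = "\<lambda>x. x \<bullet> v + c",
          OF _ flat_exp_has_derivative[unfolded has_field_derivative_def]])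
       (auto intro!: derivative_eq_intros)
  then show ?case
    by (rule Ck_Suc_if_has_derivative) (intro Ck_mult Ck_const Suc)
qed

text \<open>Raising the smooth profile \<open>exp (- 1 / t)\<close> to the power \<open>1 / (n + 1)\<close>, that is, dilating its argument, keeps its zero
set and moves its positive values up to one. The product over the faces thus increases to the indicator of the open box.\<close>

definition box_bump :: "'a::euclidean_space \<Rightarrow> 'a \<Rightarrow> nat \<Rightarrow> 'a \<Rightarrow> real" where
  "box_bump a b n x = (\<Prod>i\<in>Basis. flat_exp 1 (real (Suc n) * (x \<bullet> i - a \<bullet> i)) *
     flat_exp 1 (real (Suc n) * (b \<bullet> i - x \<bullet> i)))"

lemma Ck_box_bump: "Ck k (box_bump a b n)"
proof -
  have 1: "Ck k (\<lambda>x. flat_exp 1 (real (Suc n) * (x \<bullet> i - a \<bullet> i)))" for i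
    using Ck_flat_exp_affine[of k 1 "real (Suc n) *\<^sub>R i" "- real (Suc n) * (a \<bullet> i)"]
    by (simp add: algebra_simps del: of_nat_Suc)
  have 2: "Ck k (\<lambda>x. flat_exp 1 (real (Suc n) * (b \<bullet> i - x \<bullet> i)))" for i
    using Ck_flat_exp_affine[of k 1 "- real (Suc n) *\<^sub>R i" "real (Suc n) * (b \<bullet> i)"]
    by (simp add: algebra_simps del: of_nat_Suc)
  show ?thesis
    unfolding box_bump_def by (intro Ck_prod Ck_mult 1 2)
qed

lemma flat_exp_1_range: "0 \<le> flat_exp 1 t" "flat_exp 1 t \<le> 1"
  by (auto simp: flat_exp_def)

lemma box_bump_nonneg: "0 \<le> box_bump a b n x"
  unfolding box_bump_def by (intro prod_nonneg mult_nonneg_nonneg flat_exp_1_range ballI)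

lemma box_bump_le_1: "box_bump a b n x \<le> 1"
  unfolding box_bump_def
  by (intro prod_le_1 conjI mult_nonneg_nonneg mult_le_one flat_exp_1_range)

lemma box_bump_eq_0: "x \<notin> box a b \<Longrightarrow> box_bump a b n x = 0"
proof -
  assume "x \<notin> box a b"
  then obtain i where i: "i \<in> Basis" "x \<bullet> i \<le> a \<bullet> i \<or> b \<bullet> i \<le> x \<bullet> i"
    by (auto simp: box_def not_less)
  then have "flat_exp 1 (real (Suc n) * (x \<bullet> i - a \<bullet> i)) = 0 \<or> flat_exp 1 (real (Suc n) * (b \<bullet> i - x \<bullet> i)) = 0"
    by (auto simp: flat_exp_def zero_less_mult_iff simp del: of_nat_Suc)
  then show ?thesis using i(1) by (auto simp: box_bump_def intro!: prod_zero bexI[of _ i])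
qed

lemma box_bump_tendsto: "(\<lambda>n. box_bump a b n x) \<longlonglongrightarrow> indicator (box a b) x"
proof (cases "x \<in> box a b")
  case True
  have *: "(\<lambda>n. flat_exp 1 (real (Suc n) * t)) \<longlonglongrightarrow> 1" if "t > 0" for t
  proof -
    have "(\<lambda>n. 1 / t * inverse (real (Suc n))) \<longlonglongrightarrow> 1 / t * 0"
      by (intro tendsto_intros LIMSEQ_inverse_real_of_nat)
    then have "(\<lambda>n. exp (- (1 / t * inverse (real (Suc n))))) \<longlonglongrightarrow> exp (- 0)"
      by (intro tendsto_intros) simp
    then show ?thesis using that by (simp add: flat_exp_def divide_inverse mult_ac del: of_nat_Suc)
  qed
  have "(\<lambda>n. box_bump a b n x) \<longlonglongrightarrow> (\<Prod>i\<in>(Basis::'a set). 1 * 1)"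
    unfolding box_bump_def
    by (intro tendsto_prod tendsto_mult *) (use True in \<open>auto simp: box_def\<close>)
  then show ?thesis using True by simp
qed (simp add: box_bump_eq_0)

lemma box_bump_test_function:
  assumes "cbox a b \<subseteq> \<Omega>"
  shows "box_bump a b n \<in> test_functions \<Omega>"
proof -
  have sub: "closure {x. box_bump a b n x \<noteq> 0} \<subseteq> cbox a b"
    by (rule closure_minimal) (use box_bump_eq_0[of _ a b n] box_subset_cbox[of a b] in \<open>auto simp: closed_cbox\<close>)
  moreover from this have "compact (closure {x. box_bump a b n x \<noteq> 0})"
    by (metis bounded_cbox bounded_subset closed_closure compact_eq_bounded_closed)
  ultimately show ?thesis
    using assms by (auto simp: test_functions_def Ck_box_bump)
qed

section \<open>The fundamental lemma and the linearity of weak gradients\<close>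

text \<open>The Borel sets over which \<open>f\<close> integrates to zero form a Dynkin system that contains the boxes, which are stable under
intersection and generate the Borel sets; closure under complements is where the total integral enters. The
function is first replaced by a Borel version, because the boxes do not generate the Lebesgue sets.\<close>

lemma AE_0_if_box_integrals_0:
  fixes f :: "'a::euclidean_space \<Rightarrow> real"
  assumes f: "integrable lebesgue f"
    and boxes: "\<And>a b. (LINT x|lebesgue. indicator (box a b) x * f x) = 0"
    and total: "(LINT x|lebesgue. f x) = 0"
  shows "AE x in lebesgue. f x = 0"
proof -
  obtain g where g: "g \<in> borel_measurable lborel" "AE x in lborel. f x = g x"
    using completion_ex_borel_measurable_real[OF borel_measurable_integrable[OF f]] by blast
  have fg: "AE x in lebesgue. f x = g x"
    using g(2) by (rule AE_completion)
  have g_leb: "integrable lebesgue g"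
    using integrable_cong_AE_imp[OF f] g(1) fg
    by (metis (mono_tags, lifting) AE_cong measurable_completion)
  then have g_int: "integrable lborel g"
    using g(1) by (simp add: integrable_completion)
  have conv: "(LINT x|lborel. indicator A x * g x) = (LINT x|lebesgue. indicator A x * f x)"
    if "A \<in> sets borel" for A
  proof -
    have [measurable]: "A \<in> sets lborel" "A \<in> sets lebesgue" using that by auto
    have "(LINT x|lborel. indicator A x * g x) = (LINT x|lebesgue. indicator A x * g x)"
      using g(1) that by (intro integral_completion[symmetric]) (auto intro!: borel_measurable_times borel_measurable_indicator)
    also have "\<dots> = (LINT x|lebesgue. indicator A x * f x)"
      using f g_leb fg by (intro integral_cong_AE) auto
    finally show ?thesis .
  qed
  have total_g: "(LINT x|lborel. g x) = 0"
    using conv[of UNIV] total by simp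
  have zero: "(LINT x|lborel. indicator A x * g x) = 0" if "A \<in> sets borel" for A
  proof -
    have ind: "integrable lborel (\<lambda>x. indicator A x * g x)" if "A \<in> sets borel" for A
      using integrable_mult_indicator[OF _ g_int, of A] that by simp
    let ?E = "range (\<lambda>(a, b). box a b :: 'a set)"
    have "A \<in> sigma_sets UNIV ?E"
      using that by (simp add: borel_eq_box)
    then show ?thesis
    proof (induction rule: sigma_sets_induct_disjoint[of ?E UNIV A, OF _ _ \<open>A \<in> sigma_sets UNIV ?E\<close>])
      case 1 show ?case by (auto simp: Int_stable_def box_Int_box)
    next
      case 2 show ?case by simp
    next
      case (3 X)
      then show ?case using conv boxes by fastforce
    next
      case 4 show ?case by simp
    next
      case (5 X)
      then have X: "X \<in> sets borel" by (simp add: borel_eq_box)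
      have "(LINT x|lborel. indicator (UNIV - X) x * g x) = (LINT x|lborel. g x - indicator X x * g x)"
        by (intro Bochner_Integration.integral_cong) (auto simp: indicator_def)
      also have "\<dots> = 0"
        using ind[OF X] g_int 5 total_g by simp
      finally show ?case by simp
    next
      case (6 X)
      then have X: "X i \<in> sets borel" for i by (auto simp: borel_eq_box)
      have "set_lebesgue_integral lborel (\<Union>i. X i) g = (\<Sum>i. set_lebesgue_integral lborel (X i) g)"
        using X 6 ind[of "\<Union>i. X i"]
        by (intro lebesgue_integral_countable_add)
          (auto simp: disjoint_family_on_def set_integrable_def)
      also have "\<dots> = 0" using 6(3) 6(2)[THEN subsetD, OF rangeI] by (simp add: set_lebesgue_integral_def)
      finally show ?case by (simp add: set_lebesgue_integral_def)
    qed
  qed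
  have "AE x in lborel. g x = 0"
    using g_int zero by (intro sigma_finite_measure.density_zero[OF sigma_finite_lborel]) (auto simp: set_lebesgue_integral_def)
  then show ?thesis
    using fg by (auto dest: AE_completion)
qed

text \<open>The fundamental lemma of the calculus of variations. The bumps of a closed box inside \<open>\<Omega>\<close> converge boundedly
to the indicator of its interior, so \<open>f\<close> has zero integral over that interior. For the restriction of \<open>f\<close> to the
interior of a fixed closed box this gives zero integrals over all boxes, and \<open>\<Omega>\<close> is a countable union of closed boxes.\<close>

lemma AE_0_if_test_integrals_0:
  fixes f :: "'a::euclidean_space \<Rightarrow> real"
  assumes \<Omega>: "open \<Omega>" and f: "locally_integrable \<Omega> f"
    and test: "\<And>\<phi>. \<phi> \<in> test_functions \<Omega> \<Longrightarrow> (LINT x|lebesgue_on \<Omega>. f x * \<phi> x) = 0"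
  shows "AE x in lebesgue_on \<Omega>. f x = 0"
proof -
  have \<Omega>_sets: "\<Omega> \<in> sets lebesgue" using \<Omega> by auto
  have on_cbox: "integrable lebesgue (\<lambda>x. indicator (cbox a b) x * f x)" if "cbox a b \<subseteq> \<Omega>" for a b
    using f that integrable_restrict_space[of "cbox a b" lebesgue f]
    by (simp add: locally_integrable_def)
  have box0: "(LINT x|lebesgue. indicator (box a b) x * f x) = 0" if ab: "cbox a b \<subseteq> \<Omega>" for a b
  proof -
    have eq: "box_bump a b n x * (indicator (cbox a b) x * f x) = indicator \<Omega> x * (f x * box_bump a b n x)" for n x
      using box_bump_eq_0[of x a b n] box_subset_cbox[of a b] ab by (auto simp: indicator_def)
    have "(\<lambda>n. LINT x|lebesgue. box_bump a b n x * (indicator (cbox a b) x * f x))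
        \<longlonglongrightarrow> (LINT x|lebesgue. indicator (box a b) x * (indicator (cbox a b) x * f x))"
    proof (rule integral_dominated_convergence[where w = "\<lambda>x. \<bar>indicator (cbox a b) x * f x\<bar>"])
      show "AE x in lebesgue. (\<lambda>n. box_bump a b n x * (indicator (cbox a b) x * f x))
          \<longlonglongrightarrow> indicator (box a b) x * (indicator (cbox a b) x * f x)"
        by (intro always_eventually allI tendsto_intros box_bump_tendsto)
      show "AE x in lebesgue. norm (box_bump a b n x * (indicator (cbox a b) x * f x))
          \<le> \<bar>indicator (cbox a b) x * f x\<bar>" for n
        by (intro always_eventually allI)
          (simp add: abs_mult mult_left_le_one_le box_bump_nonneg box_bump_le_1)
      have "continuous_on UNIV (box_bump a b n)" for n
        using Ck_box_bump[of 0 a b n] by simp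
      then have "box_bump a b n \<in> borel_measurable lebesgue" for n
        by (intro measurable_completion) (simp add: borel_measurable_continuous_onI)
      then show "(\<lambda>x. box_bump a b n x * (indicator (cbox a b) x * f x)) \<in> borel_measurable lebesgue" for n
        by (rule borel_measurable_times[OF _ borel_measurable_integrable[OF on_cbox[OF ab]]])
      show "(\<lambda>x. indicator (box a b) x * (indicator (cbox a b) x * f x)) \<in> borel_measurable lebesgue"
        using borel_measurable_indicator[of "box a b" lebesgue]
        by (intro borel_measurable_times[OF _ borel_measurable_integrable[OF on_cbox[OF ab]]]) auto
    qed (use on_cbox[OF ab] in auto)
    moreover have "(LINT x|lebesgue. box_bump a b n x * (indicator (cbox a b) x * f x)) = 0" for n
      using test[OF box_bump_test_function[OF ab]] \<Omega>_sets by (simp add: eq integral_restrict_space)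
    ultimately have "(LINT x|lebesgue. indicator (box a b) x * (indicator (cbox a b) x * f x)) = 0"
      by (simp add: LIMSEQ_const_iff)
    moreover have "indicator (box a b) x * (indicator (cbox a b) x * f x) = indicator (box a b) x * f x" for x
      using box_subset_cbox[of a b] by (auto simp: indicator_def)
    ultimately show ?thesis by simp
  qed
  have AE_cbox: "AE x in lebesgue. x \<in> cbox c d \<longrightarrow> f x = 0" if cd: "cbox c d \<subseteq> \<Omega>" for c d
  proof -
    let ?g = "\<lambda>x. indicator (box c d) x * f x"
    have eq: "?g = (\<lambda>x. indicator (box c d) x *\<^sub>R (indicator (cbox c d) x * f x))"
      using box_subset_cbox[of c d] by (auto simp: indicator_def fun_eq_iff)
    have "AE x in lebesgue. ?g x = 0"
    proof (rule AE_0_if_box_integrals_0)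
      show "integrable lebesgue ?g"
        unfolding eq using on_cbox[OF cd] by (intro integrable_mult_indicator) auto
      show "(LINT x|lebesgue. ?g x) = 0" by (rule box0[OF cd])
      fix a b :: 'a
      obtain a' b' where ab': "box a b \<inter> box c d = box a' b'"
        by (simp add: box_Int_box)
      have "(LINT x|lebesgue. indicator (box a' b') x * f x) = 0"
      proof (cases "box a' b' = {}")
        case False
        then have "cbox a' b' \<subseteq> cbox c d"
          using ab' by (metis Int_lower2 box_subset_cbox closed_cbox closure_box closure_minimal order_trans)
        then show ?thesis using cd by (intro box0) auto
      qed simp
      then show "(LINT x|lebesgue. indicator (box a b) x * ?g x) = 0"
        by (simp flip: ab' add: indicator_inter_arith mult.assoc)
    qed
    moreover have "AE x in lebesgue. x \<notin> cbox c d - box c d"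
      by (intro AE_not_in) (simp flip: negligible_iff_null_sets add: negligible_frontier_interval)
    ultimately show ?thesis by eventually_elim (auto simp: indicator_def)
  qed
  obtain \<D> where \<D>: "countable \<D>" "\<D> \<subseteq> Pow \<Omega>" "\<And>X. X \<in> \<D> \<Longrightarrow> \<exists>a b. X = cbox a b" "\<Union>\<D> = \<Omega>"
    using open_countable_Union_open_cbox[OF \<Omega>] by metis
  have "AE x in lebesgue. \<forall>X\<in>\<D>. x \<in> X \<longrightarrow> f x = 0"
    using \<D>(1)
  proof (rule AE_ball_countable'[rotated])
    fix X assume "X \<in> \<D>"
    then show "AE x in lebesgue. x \<in> X \<longrightarrow> f x = 0"
      using \<D>(2,3) AE_cbox by blast
  qed
  then show ?thesis
    using \<Omega>_sets \<D>(4) by (auto simp: AE_restrict_space_iff elim!: eventually_mono)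
qed

text \<open>Membership in the Sobolev space only records the measurability of the length of the gradient; the measurability of the
field itself comes from its local integrability on countably many boxes.\<close>

lemma borel_measurable_if_locally_integrable:
  fixes f :: "'a::euclidean_space \<Rightarrow> 'b::euclidean_space"
  assumes \<Omega>: "open \<Omega>" and f: "locally_integrable \<Omega> f"
  shows "f \<in> borel_measurable (lebesgue_on \<Omega>)"
proof -
  obtain \<D> where \<D>: "countable \<D>" "\<D> \<subseteq> Pow \<Omega>" "\<And>X. X \<in> \<D> \<Longrightarrow> \<exists>a b. X = cbox a b" "\<Union>\<D> = \<Omega>"
    using open_countable_Union_open_cbox[OF \<Omega>] by metis
  show ?thesis
  proof (rule measurable_piecewise_restrict[OF \<D>(1)])
    fix X assume X: "X \<in> \<D>"
    then have "compact X" "X \<subseteq> \<Omega>" using \<D>(2) \<D>(3)[OF X] compact_cbox by blast+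
    then have "f \<in> borel_measurable (lebesgue_on X)"
      using f by (auto simp: locally_integrable_def)
    moreover have "restrict_space (lebesgue_on \<Omega>) X = lebesgue_on X"
      using \<Omega> \<open>X \<subseteq> \<Omega>\<close> by (subst restrict_restrict_space) (auto simp: Int_absorb1 intro!: borel_closed compact_imp_closed[OF \<open>compact X\<close>])
    ultimately show "f \<in> borel_measurable (restrict_space (lebesgue_on \<Omega>) X)"
      by simp
    show "X \<inter> space (lebesgue_on \<Omega>) \<in> sets (lebesgue_on \<Omega>)"
      using \<open>compact X\<close> \<open>X \<subseteq> \<Omega>\<close> \<Omega> by (auto simp: sets_restrict_space compact_imp_closed)
  qed (use \<D>(4) in auto)
qed

lemma integrable_mult_compact_support:
  fixes f \<psi> :: "'a::euclidean_space \<Rightarrow> real"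
  assumes \<Omega>: "open \<Omega>" and f: "locally_integrable \<Omega> f"
    and K: "compact K" "K \<subseteq> \<Omega>" and \<psi>: "continuous_on UNIV \<psi>" "\<And>x. x \<notin> K \<Longrightarrow> \<psi> x = 0"
  shows "integrable (lebesgue_on \<Omega>) (\<lambda>x. f x * \<psi> x)"
proof -
  obtain B where B: "\<And>x. x \<in> K \<Longrightarrow> \<bar>\<psi> x\<bar> \<le> B"
    using compact_imp_bounded[OF compact_continuous_image[OF continuous_on_subset[OF \<psi>(1)] K(1)]]
    unfolding bounded_iff by auto
  have K': "K \<in> sets lebesgue" using compact_imp_closed[OF K(1)] by auto
  have i: "integrable lebesgue (\<lambda>x. indicator K x *\<^sub>R f x)"
    using f K K' by (auto simp: locally_integrable_def integrable_restrict_space)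
  have [measurable]: "\<psi> \<in> borel_measurable lebesgue"
    using \<psi>(1) by (intro measurable_completion) (simp add: borel_measurable_continuous_onI)
  have "integrable lebesgue (\<lambda>x. indicator K x *\<^sub>R f x * \<psi> x)"
  proof (rule Bochner_Integration.integrable_bound)
    show "integrable lebesgue (\<lambda>x. B * (indicator K x *\<^sub>R f x))" using i by simp
    show "AE x in lebesgue. norm (indicator K x *\<^sub>R f x * \<psi> x) \<le> norm (B * (indicator K x *\<^sub>R f x))"
    proof (intro always_eventually allI)
      fix x show "norm (indicator K x *\<^sub>R f x * \<psi> x) \<le> norm (B * (indicator K x *\<^sub>R f x))"
        using B[of x] by (auto simp: indicator_def abs_mult mult.commute intro!: mult_right_mono)
    qed
  qed (use borel_measurable_integrable[OF i] in measurable)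
  moreover have "indicator K x *\<^sub>R f x * \<psi> x = indicator \<Omega> x *\<^sub>R (f x * \<psi> x)" for x
    using K \<psi>(2)[of x] by (auto simp: indicator_def)
  ultimately have "integrable lebesgue (\<lambda>x. indicator \<Omega> x *\<^sub>R (f x * \<psi> x))" by (simp only:)
  then show ?thesis using \<Omega> by (intro integrable_restrict_space[THEN iffD2]) auto
qed

lemma frechet_derivative_outside_support:
  assumes "x \<notin> closure {x. \<phi> x \<noteq> (0::real)}"
  shows "frechet_derivative \<phi> (at x) = (\<lambda>h. 0)"
proof (rule frechet_derivative_eqI)
  show "(\<phi> has_derivative (\<lambda>h. 0)) (at x)"
    by (rule has_derivative_transform_within_open[of "\<lambda>x. 0" _ _ _ "- closure {x. \<phi> x \<noteq> 0}"])
      (use assms closure_subset[of "{x. \<phi> x \<noteq> 0}"] in auto)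
qed

lemma test_pairings_integrable:
  fixes f :: "'a::euclidean_space \<Rightarrow> real"
  assumes \<Omega>: "open \<Omega>" and \<phi>: "\<phi> \<in> test_functions \<Omega>" and f: "locally_integrable \<Omega> f"
  shows "integrable (lebesgue_on \<Omega>) (\<lambda>x. f x * \<phi> x)"
    and "i \<in> Basis \<Longrightarrow> integrable (lebesgue_on \<Omega>) (\<lambda>x. f x * frechet_derivative \<phi> (at x) i)"
proof -
  have K: "compact (closure {x. \<phi> x \<noteq> 0})" "closure {x. \<phi> x \<noteq> 0} \<subseteq> \<Omega>"
    and C: "Ck 0 \<phi>" "Ck (Suc 0) \<phi>"
    using \<phi> unfolding test_functions_def by blast+
  show "integrable (lebesgue_on \<Omega>) (\<lambda>x. f x * \<phi> x)"
    using C(1) closure_subset[of "{x. \<phi> x \<noteq> 0}"]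
    by (intro integrable_mult_compact_support[OF \<Omega> f K]) auto
  show "integrable (lebesgue_on \<Omega>) (\<lambda>x. f x * frechet_derivative \<phi> (at x) i)" if "i \<in> Basis"
    using C(2) that frechet_derivative_outside_support[of _ \<phi>]
    by (intro integrable_mult_compact_support[OF \<Omega> f K]) auto
qed

lemma locally_integrable_inner:
  "locally_integrable \<Omega> g \<Longrightarrow> locally_integrable \<Omega> (\<lambda>x. g x \<bullet> i)"
  by (simp add: locally_integrable_def)

lemma is_weak_gradientD:
  assumes "is_weak_gradient \<Omega> u g" "\<phi> \<in> test_functions \<Omega>" "i \<in> Basis"
  shows "(LINT x|lebesgue_on \<Omega>. u x * frechet_derivative \<phi> (at x) i)
    = - (LINT x|lebesgue_on \<Omega>. (g x \<bullet> i) * \<phi> x)"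
  using assms by (simp add: is_weak_gradient_def)

text \<open>Two weak gradients have the same pairing with every test function, so the fundamental lemma applies to each
component of their difference. This is what makes the chosen gradient linear up to null sets.\<close>

lemma is_weak_gradient_unique:
  assumes \<Omega>: "open \<Omega>" and g: "is_weak_gradient \<Omega> u g" and h: "is_weak_gradient \<Omega> u h"
  shows "AE x in lebesgue_on \<Omega>. g x = h x"
proof -
  have loc: "locally_integrable \<Omega> (\<lambda>x. g x \<bullet> i)" "locally_integrable \<Omega> (\<lambda>x. h x \<bullet> i)" for i
    using g h by (auto simp: is_weak_gradient_def intro: locally_integrable_inner)
  have "AE x in lebesgue_on \<Omega>. g x \<bullet> i - h x \<bullet> i = 0" if i: "i \<in> Basis" for i
  proof (rule AE_0_if_test_integrals_0[OF \<Omega>])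
    show "locally_integrable \<Omega> (\<lambda>x. g x \<bullet> i - h x \<bullet> i)"
      using loc[of i] by (simp add: locally_integrable_def)
    fix \<phi> assume \<phi>: "\<phi> \<in> test_functions \<Omega>"
    have "(LINT x|lebesgue_on \<Omega>. (g x \<bullet> i) * \<phi> x) = (LINT x|lebesgue_on \<Omega>. (h x \<bullet> i) * \<phi> x)"
      using is_weak_gradientD[OF g \<phi> i] is_weak_gradientD[OF h \<phi> i] by simp
    then show "(LINT x|lebesgue_on \<Omega>. (g x \<bullet> i - h x \<bullet> i) * \<phi> x) = 0"
      using test_pairings_integrable(1)[OF \<Omega> \<phi> loc(1)[of i]] test_pairings_integrable(1)[OF \<Omega> \<phi> loc(2)[of i]]
      by (simp add: left_diff_distrib)
  qed
  then have "AE x in lebesgue_on \<Omega>. \<forall>i\<in>Basis. g x \<bullet> i - h x \<bullet> i = 0"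
    by (intro AE_finite_allI) auto
  then show ?thesis by eventually_elim (auto intro: euclidean_eqI)
qed

lemma is_weak_gradient_add:
  assumes \<Omega>: "open \<Omega>" and u: "is_weak_gradient \<Omega> u g" and v: "is_weak_gradient \<Omega> v h"
  shows "is_weak_gradient \<Omega> (\<lambda>x. u x + v x) (\<lambda>x. g x + h x)"
proof -
  have loc: "locally_integrable \<Omega> u" "locally_integrable \<Omega> v"
    "locally_integrable \<Omega> g" "locally_integrable \<Omega> h"
    using u v by (auto simp: is_weak_gradient_def)
  have "(LINT x|lebesgue_on \<Omega>. (u x + v x) * frechet_derivative \<phi> (at x) i)
          = - (LINT x|lebesgue_on \<Omega>. ((g x + h x) \<bullet> i) * \<phi> x)"
    if \<phi>: "\<phi> \<in> test_functions \<Omega>" and i: "i \<in> Basis" for \<phi> i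
    using is_weak_gradientD[OF u \<phi> i] is_weak_gradientD[OF v \<phi> i]
      test_pairings_integrable(2)[OF \<Omega> \<phi> loc(1) i] test_pairings_integrable(2)[OF \<Omega> \<phi> loc(2) i]
      test_pairings_integrable(1)[OF \<Omega> \<phi> locally_integrable_inner[OF loc(3)]]
      test_pairings_integrable(1)[OF \<Omega> \<phi> locally_integrable_inner[OF loc(4)]]
    by (simp add: distrib_right inner_add_left)
  then show ?thesis using loc by (simp add: is_weak_gradient_def locally_integrable_def)
qed

lemma is_weak_gradient_scale:
  assumes u: "is_weak_gradient \<Omega> u g"
  shows "is_weak_gradient \<Omega> (\<lambda>x. c * u x) (\<lambda>x. c *\<^sub>R g x)"
  using u unfolding is_weak_gradient_def locally_integrable_def by (simp add: mult.assoc)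

lemma weak_gradient_is_weak_gradient:
  "weakly_differentiable \<Omega> u \<Longrightarrow> is_weak_gradient \<Omega> u (weak_gradient \<Omega> u)"
  unfolding weakly_differentiable_def weak_gradient_def by (erule someI_ex)

lemma weak_gradient_AE_eq:
  assumes "open \<Omega>" "is_weak_gradient \<Omega> u g"
  shows "AE x in lebesgue_on \<Omega>. weak_gradient \<Omega> u x = g x"
  using assms is_weak_gradient_unique weak_gradient_is_weak_gradient weakly_differentiable_def by blast

section \<open>Pointwise estimates for the energy density and its gradient\<close>

definition radial_energy ::
    "('a \<Rightarrow> real) \<Rightarrow> ('a \<Rightarrow> real) \<Rightarrow> ('a \<Rightarrow> real) \<Rightarrow> 'a \<Rightarrow> real \<Rightarrow> real" where
  "radial_energy p q \<mu> x t = t powr p x / p x + \<mu> x * (t powr q x / q x) * ln (exp 1 + t)"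

definition log_factor :: "('a \<Rightarrow> real) \<Rightarrow> 'a \<Rightarrow> real \<Rightarrow> real" where
  "log_factor q x t = ln (exp 1 + t) + t / (q x * (exp 1 + t))"

definition radial_flux ::
    "('a \<Rightarrow> real) \<Rightarrow> ('a \<Rightarrow> real) \<Rightarrow> ('a \<Rightarrow> real) \<Rightarrow> 'a \<Rightarrow> real \<Rightarrow> real" where
  "radial_flux p q \<mu> x t = t powr (p x - 1) + \<mu> x * log_factor q x t * t powr (q x - 1)"

text \<open>The gradient of \<open>energy_density\<close> in its last argument, as one vector field. The two parts are estimated together because
convexity bounds the remainder of their sum.\<close>

definition flux ::
    "('a \<Rightarrow> real) \<Rightarrow> ('a \<Rightarrow> real) \<Rightarrow> ('a \<Rightarrow> real) \<Rightarrow> 'a \<Rightarrow> 'a::euclidean_space \<Rightarrow> 'a" where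
  "flux p q \<mu> x \<xi> = p_flux p x \<xi> + q_log_flux q \<mu> x \<xi>"

lemma energy_density_eq_radial: "energy_density p q \<mu> x \<xi> = radial_energy p q \<mu> x (norm \<xi>)"
  by (simp add: energy_density_def radial_energy_def)

lemma powr_scaleR_eq_sgn:
  "(norm \<xi> powr (r - 2)) *\<^sub>R (\<xi>::'a::real_normed_vector) = (norm \<xi> powr (r - 1)) *\<^sub>R sgn \<xi>"
proof (cases "\<xi> = 0")
  case False
  then have "norm \<xi> powr (r - 1) = norm \<xi> powr (r - 2) * norm \<xi>"
    using powr_add[of "norm \<xi>" "r - 2" 1] by simp
  with False show ?thesis by (simp add: sgn_div_norm)
qed simp

lemma flux_eq_radial: "flux p q \<mu> x \<xi> = radial_flux p q \<mu> x (norm \<xi>) *\<^sub>R sgn \<xi>"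
proof -
  have "q_log_flux q \<mu> x \<xi> =
      (\<mu> x * log_factor q x (norm \<xi>)) *\<^sub>R ((norm \<xi> powr (q x - 2)) *\<^sub>R \<xi>)"
    by (simp add: q_log_flux_def log_factor_def)
  then show ?thesis
    by (simp add: flux_def p_flux_def powr_scaleR_eq_sgn radial_flux_def scaleR_add_left)
qed

lemma norm_sgn_diff_le:
  fixes a b :: "'a::real_normed_vector"
  assumes "b \<noteq> 0"
  shows "norm (sgn a - sgn b) \<le> 2 * norm (a - b) / norm b"
proof (cases "a = 0")
  case False
  have "norm b *\<^sub>R (sgn a - sgn b) = (norm b - norm a) *\<^sub>R sgn a + (a - b)"
    using assms False by (simp add: sgn_div_norm algebra_simps)
  then have "norm b * norm (sgn a - sgn b) = norm ((norm b - norm a) *\<^sub>R sgn a + (a - b))"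
    by (metis norm_scaleR abs_norm_cancel)
  also have "\<dots> \<le> \<bar>norm b - norm a\<bar> * norm (sgn a) + norm (a - b)"
    by (metis norm_triangle_ineq norm_scaleR)
  also have "\<dots> \<le> 2 * norm (a - b)"
    using False norm_triangle_ineq3[of b a] by (simp add: norm_sgn norm_minus_commute)
  finally show ?thesis using assms by (simp add: field_simps)
qed (use assms in \<open>simp add: norm_sgn\<close>)

text \<open>The hypotheses at a single point \<open>x\<close>. All constants below depend on \<open>\<sigma>\<close> and \<open>K\<close> alone, which makes the
estimates uniform in \<open>x\<close>; the weight is only integrable, so constants depending on \<open>\<mu> x\<close> would be useless.\<close>

locale growth_at =
  fixes p q \<mu> :: "'a::euclidean_space \<Rightarrow> real" and x :: 'a and \<sigma> K :: real
  assumes exponents: "1 < \<sigma>" "\<sigma> \<le> p x" "p x \<le> q x" "q x \<le> K" and weight: "0 \<le> \<mu> x"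
begin

lemma exponent_bounds: "1 < p x" "1 < q x" "1 < K" "\<sigma> \<le> q x" "p x \<le> K"
  using exponents by auto

abbreviation "H \<equiv> H_log p q \<mu> x"
abbreviation "f \<equiv> radial_flux p q \<mu> x"
abbreviation "F \<equiv> radial_energy p q \<mu> x"

lemma exp_1_add_pos: "0 \<le> t \<Longrightarrow> 0 < exp 1 + (t::real)"
  by (intro add_pos_nonneg) auto

lemma log_ge_1: "0 \<le> t \<Longrightarrow> 1 \<le> ln (exp 1 + (t::real))"
  using exp_1_add_pos[of t] by (subst ln_ge_iff) auto

lemma log_mono: "0 \<le> s \<Longrightarrow> s \<le> t \<Longrightarrow> ln (exp 1 + s) \<le> ln (exp 1 + (t::real))"
  using exp_1_add_pos[of s] exp_1_add_pos[of t] by (subst ln_le_cancel_iff) auto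

text \<open>As \<open>e + l t \<le> l (e + t)\<close>, the logarithm grows by at most \<open>ln l \<le> l - 1\<close>, and \<open>1 \<le> ln (e + t)\<close> absorbs this additive
term into the factor \<open>l\<close>.\<close>

lemma log_dilation:
  fixes l t :: real
  assumes "1 \<le> l" "0 \<le> t" shows "ln (exp 1 + l * t) \<le> l * ln (exp 1 + t)"
proof -
  have pos: "0 < exp 1 + t" using assms(2) by (rule exp_1_add_pos)
  have "exp 1 + l * t \<le> l * (exp 1 + t)"
    using assms mult_right_mono[of 1 l "exp 1"] by (simp add: distrib_left)
  moreover have "0 < exp 1 + l * t" using assms by (intro add_pos_nonneg) auto
  ultimately have "ln (exp 1 + l * t) \<le> ln (l * (exp 1 + t))"
    using assms pos by (subst ln_le_cancel_iff) auto
  also have "\<dots> = ln l + ln (exp 1 + t)"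
    using assms pos by (intro ln_mult_pos) auto
  also have "ln l \<le> (l - 1) * ln (exp 1 + t)"
    using ln_le_minus_one[of l] log_ge_1[OF assms(2)] assms mult_left_mono[of 1 "ln (exp 1 + t)" "l - 1"] by auto
  finally show ?thesis by (simp add: algebra_simps)
qed

lemma quotient_mono: "0 \<le> s \<Longrightarrow> s \<le> t \<Longrightarrow> s / (q x * (exp 1 + s)) \<le> t / (q x * (exp 1 + t))"
proof -
  assume st: "0 \<le> s" "s \<le> t"
  then have "0 < exp 1 + s" "0 < exp 1 + t" by (auto intro: exp_1_add_pos)
  moreover have "s * (exp 1 + t) \<le> t * (exp 1 + s)" using st by (simp add: algebra_simps)
  ultimately have "s / (exp 1 + s) \<le> t / (exp 1 + t)" by (simp add: divide_simps mult.commute)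
  then have "s / (exp 1 + s) / q x \<le> t / (exp 1 + t) / q x"
    using exponent_bounds by (intro divide_right_mono) auto
  then show ?thesis by (simp add: mult.commute)
qed

lemma log_factor_bounds:
  assumes "0 \<le> t" shows "ln (exp 1 + t) \<le> log_factor q x t" "log_factor q x t \<le> 2 * ln (exp 1 + t)"
proof -
  have pos: "0 < exp 1 + t" using assms by (rule exp_1_add_pos)
  then show "ln (exp 1 + t) \<le> log_factor q x t"
    using assms exponent_bounds by (simp add: log_factor_def)
  have "1 * (exp 1 + t) \<le> q x * (exp 1 + t)"
    using exponent_bounds pos by (intro mult_right_mono) auto
  moreover have "t \<le> 1 * (exp 1 + t)" by simp
  ultimately have "t \<le> q x * (exp 1 + t)" by (rule order_trans[rotated])
  then have "t / (q x * (exp 1 + t)) \<le> 1" using pos exponent_bounds by (simp add: divide_le_eq)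
  then show "log_factor q x t \<le> 2 * ln (exp 1 + t)"
    using log_ge_1[OF assms] by (simp add: log_factor_def)
qed

lemma log_factor_mono: "0 \<le> s \<Longrightarrow> s \<le> t \<Longrightarrow> log_factor q x s \<le> log_factor q x t"
  unfolding log_factor_def by (intro add_mono log_mono quotient_mono)

lemma log_factor_ge_1: "0 \<le> t \<Longrightarrow> 1 \<le> log_factor q x t"
  using log_ge_1 log_factor_bounds(1) order_trans by blast

lemma log_factor_dilation:
  assumes "1 \<le> l" "0 \<le> t" shows "log_factor q x (l * t) \<le> l * log_factor q x t"
proof -
  have lt: "t \<le> l * t" using assms mult_right_mono[of 1 l t] by simp
  have "l * t / (q x * (exp 1 + l * t)) \<le> l * t / (q x * (exp 1 + t))"
  proof (rule divide_left_mono)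
    show "q x * (exp 1 + t) \<le> q x * (exp 1 + l * t)"
      using lt exponent_bounds by (intro mult_left_mono) auto
    show "0 < q x * (exp 1 + l * t) * (q x * (exp 1 + t))"
      using assms exponent_bounds by (intro mult_pos_pos add_pos_nonneg) auto
  qed (use assms in auto)
  with log_dilation[OF assms] show ?thesis by (simp add: log_factor_def distrib_left)
qed

lemma radial_flux_nonneg: "0 \<le> t \<Longrightarrow> 0 \<le> f t"
  using log_factor_ge_1[of t] weight by (auto simp: radial_flux_def)

lemma radial_flux_mono:
  assumes "0 \<le> s" "s \<le> t" shows "f s \<le> f t"
  unfolding radial_flux_def
proof (intro add_mono mult_mono)
  show "log_factor q x s \<le> log_factor q x t" by (rule log_factor_mono[OF assms])
  show "0 \<le> \<mu> x * log_factor q x t"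
    using log_factor_ge_1[of t] weight assms by auto
qed (use assms exponent_bounds weight log_factor_ge_1[of s] in \<open>auto intro!: powr_mono2\<close>)

lemma H_nonneg: "0 \<le> t \<Longrightarrow> 0 \<le> H t"
  using log_ge_1[of t] weight by (auto simp: H_log_def)

lemma H_mono:
  assumes "0 \<le> s" "s \<le> t" shows "H s \<le> H t"
  unfolding H_log_def
proof (intro add_mono mult_mono)
  show "ln (exp 1 + s) \<le> ln (exp 1 + t)" by (rule log_mono[OF assms])
qed (use assms exponent_bounds weight log_ge_1[of s] in \<open>auto intro!: powr_mono2\<close>)

lemma times_powr_minus_1: "0 \<le> t \<Longrightarrow> t * t powr (r - 1) = t powr r" for r t :: real
  using powr_mult_base[of t "r - 1"] by simp

lemma times_radial_flux_eq:
  assumes "0 \<le> t" shows "t * f t = t powr p x + \<mu> x * t powr q x * log_factor q x t"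
proof -
  have "t * f t = t * t powr (p x - 1) + \<mu> x * (t * t powr (q x - 1)) * log_factor q x t"
    by (simp add: radial_flux_def algebra_simps)
  then show ?thesis by (simp only: times_powr_minus_1[OF assms])
qed

lemma times_radial_flux_le_H: assumes "0 \<le> t" shows "t * f t \<le> 2 * H t"
proof -
  have "\<mu> x * t powr q x * log_factor q x t \<le> \<mu> x * t powr q x * (2 * ln (exp 1 + t))"
    using weight log_factor_bounds(2)[OF assms] by (intro mult_left_mono) auto
  then show ?thesis
    unfolding times_radial_flux_eq[OF assms] H_log_def using add_mono[OF powr_ge_zero[of t "p x"]] by (simp add: mult_ac)
qed

lemma H_dilation:
  assumes "1 \<le> l" "0 \<le> t" shows "H (l * t) \<le> l powr (K + 1) * H t"
proof -
  have l: "l powr p x \<le> l powr (K + 1)" "l powr q x * l \<le> l powr (K + 1)"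
    using assms exponent_bounds exponents powr_mono[of _ "K + 1" l] times_powr_minus_1[of l "q x + 1"]
    by (simp_all add: mult.commute divide_inverse mult.left_commute)
  have "H (l * t) = l powr p x * t powr p x + \<mu> x * (l powr q x * t powr q x) * ln (exp 1 + l * t)"
    using assms by (simp add: H_log_def powr_mult)
  also have "\<dots> \<le> l powr p x * t powr p x + \<mu> x * (l powr q x * t powr q x) * (l * ln (exp 1 + t))"
    using weight log_dilation[OF assms] by (intro add_left_mono mult_left_mono) auto
  also have "\<dots> = l powr p x * t powr p x + (l powr q x * l) * (\<mu> x * t powr q x * ln (exp 1 + t))"
    by (simp add: algebra_simps)
  also have "\<dots> \<le> l powr (K + 1) * t powr p x + l powr (K + 1) * (\<mu> x * t powr q x * ln (exp 1 + t))"
    using weight log_ge_1[OF assms(2)] l by (intro add_mono mult_right_mono) auto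
  finally show ?thesis by (simp add: H_log_def distrib_left)
qed

lemma H_contraction:
  assumes "0 < k" "k \<le> 1" "0 \<le> t" shows "H (k * t) \<le> k powr \<sigma> * H t"
proof -
  have k: "k powr p x \<le> k powr \<sigma>" "k powr q x \<le> k powr \<sigma>"
    using assms exponent_bounds exponents by (auto intro!: powr_mono')
  have kt: "k * t \<le> t" using assms by (simp add: mult_left_le_one_le)
  have "H (k * t) = k powr p x * t powr p x + k powr q x * (\<mu> x * t powr q x * ln (exp 1 + k * t))"
    using assms by (simp add: H_log_def powr_mult)
  also have "\<dots> \<le> k powr \<sigma> * t powr p x + k powr \<sigma> * (\<mu> x * t powr q x * ln (exp 1 + t))"
    using weight log_ge_1[of "k * t"] log_mono[OF _ kt] k assms by (intro add_mono mult_mono) auto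
  finally show ?thesis by (simp add: H_log_def distrib_left)
qed

lemma H_add_le:
  assumes "0 \<le> s" "0 \<le> t" shows "H (s + t) \<le> 2 powr (K + 1) * (H s + H t)"
proof -
  have "H (s + t) \<le> H (2 * max s t)" using assms by (intro H_mono) auto
  also have "\<dots> \<le> 2 powr (K + 1) * H (max s t)" using assms by (intro H_dilation) auto
  also have "H (max s t) \<le> H s + H t" using assms H_nonneg[of s] H_nonneg[of t] by (auto simp: max_def)
  finally show ?thesis by simp
qed

lemma radial_flux_dilation:
  assumes "1 \<le> l" "0 \<le> t" shows "f (l * t) \<le> l powr K * f t"
proof -
  have l: "l powr (p x - 1) \<le> l powr K" "l powr (q x - 1) * l \<le> l powr K"
    using assms exponent_bounds exponents powr_mono[of _ K l] times_powr_minus_1[of l "q x"]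
    by (simp_all add: mult.commute divide_inverse mult.left_commute)
  have "f (l * t) = l powr (p x - 1) * t powr (p x - 1) +
      \<mu> x * log_factor q x (l * t) * (l powr (q x - 1) * t powr (q x - 1))"
    using assms by (simp add: radial_flux_def powr_mult)
  also have "\<dots> \<le> l powr (p x - 1) * t powr (p x - 1) +
      \<mu> x * (l * log_factor q x t) * (l powr (q x - 1) * t powr (q x - 1))"
    using weight log_factor_dilation[OF assms] by (intro add_left_mono mult_right_mono mult_left_mono) auto
  also have "\<dots> = l powr (p x - 1) * t powr (p x - 1) +
      (l powr (q x - 1) * l) * (\<mu> x * log_factor q x t * t powr (q x - 1))"
    by (simp add: algebra_simps)
  also have "\<dots> \<le> l powr K * t powr (p x - 1) + l powr K * (\<mu> x * log_factor q x t * t powr (q x - 1))"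
    using weight log_factor_ge_1[OF assms(2)] l by (intro add_mono mult_right_mono) auto
  finally show ?thesis by (simp add: radial_flux_def distrib_left)
qed

text \<open>The dilation bound applied to \<open>k t\<close> with factor \<open>1 / k\<close>.\<close>

lemma radial_flux_contraction:
  assumes "0 < k" "k \<le> 1" "0 \<le> t" shows "k powr K * f t \<le> f (k * t)"
proof -
  have "f (1 / k * (k * t)) \<le> (1 / k) powr K * f (k * t)"
    using assms by (intro radial_flux_dilation) auto
  then show ?thesis using assms by (simp add: powr_divide field_simps)
qed

text \<open>A Young inequality without the conjugate function: if \<open>a \<le> k b\<close>, then \<open>f(a) b\<close> is at most \<open>f(k b) b\<close>, of order
\<open>H(k b) / k\<close>, which contraction bounds by \<open>k powr (\<sigma> - 1) H(b)\<close>; otherwise \<open>b < a / k\<close>. The coefficient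
of \<open>H(b)\<close> tends to zero with \<open>k\<close> exactly because \<open>\<sigma> > 1\<close>.\<close>

lemma young_radial_flux:
  assumes "0 \<le> a" "0 \<le> b" "0 < k" "k \<le> 1"
  shows "f a * b \<le> 2 / k * H a + 2 * k powr (\<sigma> - 1) * H b"
proof (cases "a \<le> k * b")
  case True
  have "f a * b \<le> f (k * b) * b"
    using radial_flux_mono[OF assms(1) True] assms by (intro mult_right_mono) auto
  also have "\<dots> = (k * b * f (k * b)) / k" using assms by simp
  also have "\<dots> \<le> 2 * H (k * b) / k" using assms by (intro divide_right_mono times_radial_flux_le_H) auto
  also have "\<dots> \<le> 2 * (k powr \<sigma> * H b) / k"
    using assms H_contraction[of k b] by (intro divide_right_mono mult_left_mono) auto
  also have "\<dots> = 2 * k powr (\<sigma> - 1) * H b" using assms by (simp add: powr_diff)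
  finally show ?thesis using H_nonneg[OF assms(1)] assms by (simp add: add_increasing)
next
  case False
  then have "b \<le> a / k" using assms by (simp add: field_simps)
  then have "f a * b \<le> f a * (a / k)" using radial_flux_nonneg[OF assms(1)] by (intro mult_left_mono) auto
  also have "\<dots> \<le> 2 * H a / k"
    using times_radial_flux_le_H[OF assms(1)] assms by (simp add: divide_right_mono mult.commute)
  finally show ?thesis using H_nonneg[OF assms(2)] assms by (simp add: add_increasing2)
qed

lemma norm_flux_eq: "norm (flux p q \<mu> x \<xi>) = f (norm \<xi>)"
proof -
  have "f 0 = 0" by (simp add: radial_flux_def)
  then show ?thesis using radial_flux_nonneg[of "norm \<xi>"] by (simp add: flux_eq_radial norm_sgn)
qed

lemma p_flux_le: "norm (p_flux p x \<xi>) \<le> f (norm \<xi>)"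
  using weight log_factor_ge_1[of "norm \<xi>"]
  by (simp add: p_flux_def powr_scaleR_eq_sgn norm_sgn radial_flux_def)

text \<open>A modulus of continuity relative to the size of the flux. For a large increment, \<open>\<tau> |\<xi>| \<le> |\<eta>|\<close>, both values are
controlled by \<open>f\<close> at \<open>(1 + 1 / \<tau>) |\<eta>|\<close>. For a small one, \<open>|\<xi> + \<eta>|\<close> lies between \<open>(1 - \<tau>) |\<xi>|\<close> and \<open>(1 + \<tau>) |\<xi>|\<close>, so
the dilation bounds control the change of length of the flux, and its direction turns by at most \<open>2 \<tau>\<close>. The
coefficient of \<open>f(|\<xi>|)\<close> tends to zero with \<open>\<tau>\<close>.\<close>

lemma flux_oscillation:
  assumes "0 < \<tau>" "\<tau> < 1"
  shows "norm (flux p q \<mu> x (\<xi> + \<eta>) - flux p q \<mu> x \<xi>)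
    \<le> ((1 + \<tau>) powr K - (1 - \<tau>) powr K + 2 * \<tau>) * f (norm \<xi>) + 2 * (1 + 1 / \<tau>) powr K * f (norm \<eta>)"
    (is "_ \<le> ?\<omega> * _ + ?C * _")
proof -
  let ?a = "flux p q \<mu> x"
  have \<omega>: "0 \<le> (1 + \<tau>) powr K - (1 - \<tau>) powr K"
    using assms exponent_bounds by (simp add: powr_mono2)
  show ?thesis
  proof (cases "\<tau> * norm \<xi> \<le> norm \<eta>")
    case True
    then have \<xi>: "norm \<xi> \<le> norm \<eta> / \<tau>" using assms by (simp add: field_simps)
    have big: "f t \<le> (1 + 1 / \<tau>) powr K * f (norm \<eta>)" if "0 \<le> t" "t \<le> (1 + 1 / \<tau>) * norm \<eta>" for t
      using radial_flux_mono[OF that] radial_flux_dilation[of "1 + 1 / \<tau>" "norm \<eta>"] assms by simp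
    have "norm (\<xi> + \<eta>) \<le> (1 + 1 / \<tau>) * norm \<eta>"
      using norm_triangle_ineq[of \<xi> \<eta>] \<xi> by (simp add: distrib_right)
    moreover have "norm \<xi> \<le> (1 + 1 / \<tau>) * norm \<eta>"
      using \<xi> by (simp add: distrib_right add_increasing)
    ultimately have "norm (?a (\<xi> + \<eta>)) + norm (?a \<xi>) \<le> ?C * f (norm \<eta>)"
      using big[of "norm (\<xi> + \<eta>)"] big[of "norm \<xi>"] by (simp add: norm_flux_eq)
    moreover have "0 \<le> ?\<omega> * f (norm \<xi>)" using \<omega> assms radial_flux_nonneg by simp
    ultimately show ?thesis
      using norm_triangle_ineq4[of "?a (\<xi> + \<eta>)" "?a \<xi>"] by linarith
  next
    case False
    then have \<xi>: "\<xi> \<noteq> 0" using assms by auto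
    let ?s = "norm (\<xi> + \<eta>)" and ?t = "norm \<xi>"
    have up: "?s \<le> (1 + \<tau>) * ?t" and lo: "(1 - \<tau>) * ?t \<le> ?s"
      using False norm_triangle_ineq[of \<xi> \<eta>] norm_diff_ineq[of \<xi> \<eta>] by (simp_all add: algebra_simps)
    have "f ?s \<le> (1 + \<tau>) powr K * f ?t"
      using radial_flux_mono[OF _ up] radial_flux_dilation[of "1 + \<tau>" ?t] assms by simp
    moreover have "(1 - \<tau>) powr K * f ?t \<le> f ?s"
      using radial_flux_mono[OF _ lo] radial_flux_contraction[of "1 - \<tau>" ?t] assms by simp
    moreover have "f ?t \<le> (1 + \<tau>) powr K * f ?t" "(1 - \<tau>) powr K * f ?t \<le> f ?t"
      using radial_flux_nonneg[of ?t] assms exponent_bounds by (auto intro!: mult_right_mono mult_left_le_one_le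
          ge_one_powr_ge_zero powr_le1 simp: mult_le_cancel_right1)
    ultimately have radial: "\<bar>f ?s - f ?t\<bar> \<le> ((1 + \<tau>) powr K - (1 - \<tau>) powr K) * f ?t"
      by (simp add: abs_le_iff left_diff_distrib)
    have "norm (sgn (\<xi> + \<eta>) - sgn \<xi>) \<le> 2 * norm \<eta> / ?t"
      using norm_sgn_diff_le[OF \<xi>, of "\<xi> + \<eta>"] by simp
    also have "\<dots> \<le> 2 * \<tau>" using False \<xi> by (simp add: field_simps)
    finally have angular: "norm (sgn (\<xi> + \<eta>) - sgn \<xi>) \<le> 2 * \<tau>" .
    have "?a (\<xi> + \<eta>) - ?a \<xi> = (f ?s - f ?t) *\<^sub>R sgn (\<xi> + \<eta>) + f ?t *\<^sub>R (sgn (\<xi> + \<eta>) - sgn \<xi>)"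
      by (simp add: flux_eq_radial algebra_simps)
    then have "norm (?a (\<xi> + \<eta>) - ?a \<xi>)
        \<le> \<bar>f ?s - f ?t\<bar> * norm (sgn (\<xi> + \<eta>)) + \<bar>f ?t\<bar> * norm (sgn (\<xi> + \<eta>) - sgn \<xi>)"
      by (metis norm_triangle_ineq norm_scaleR)
    also have "\<dots> \<le> ((1 + \<tau>) powr K - (1 - \<tau>) powr K) * f ?t * 1 + f ?t * (2 * \<tau>)"
      using radial angular radial_flux_nonneg[of ?t] \<omega> by (intro add_mono mult_mono) (auto simp: norm_sgn)
    also have "\<dots> = ?\<omega> * f ?t" by (simp add: algebra_simps)
    also have "\<dots> \<le> ?\<omega> * f ?t + ?C * f (norm \<eta>)" using radial_flux_nonneg[of "norm \<eta>"] by simp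
    finally show ?thesis .
  qed
qed

lemma radial_energy_has_derivative:
  assumes "0 < t" shows "(F has_real_derivative f t) (at t)"
proof -
  have "0 < exp 1 + t" using assms by (simp add: exp_1_add_pos)
  then have "((\<lambda>t. ln (exp 1 + t)) has_real_derivative 1 / (exp 1 + t)) (at t)"
    by (auto intro!: derivative_eq_intros)
  moreover have "((\<lambda>t. t powr r / r) has_real_derivative t powr (r - 1)) (at t)" if "1 < r" for r
    using DERIV_cdivide[OF has_real_derivative_powr[OF assms, of r], of r] that by simp
  note this[OF exponent_bounds(1)] this[OF exponent_bounds(2)]
  ultimately have "(F has_real_derivative t powr (p x - 1) +
      \<mu> x * (t powr (q x - 1) * ln (exp 1 + t) + t powr q x / q x * (1 / (exp 1 + t)))) (at t)"
    unfolding radial_energy_def [abs_def] mult.assoc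
    by (intro DERIV_add DERIV_cmult DERIV_cong[OF DERIV_mult]) (auto simp: field_simps)
  also have "t powr q x = t * t powr (q x - 1)" using assms by (simp add: times_powr_minus_1)
  finally show ?thesis by (simp add: radial_flux_def log_factor_def algebra_simps)
qed

lemma radial_energy_continuous: "continuous_on {0..} F"
proof -
  have "exp 1 + t \<noteq> 0" if "0 \<le> t" for t :: real using exp_1_add_pos[OF that] by simp
  then show ?thesis
    unfolding radial_energy_def [abs_def] using exponent_bounds
    by (intro continuous_intros continuous_on_powr') auto
qed

lemma radial_energy_subgradient:
  assumes "0 \<le> s" "0 \<le> t" shows "f t * (s - t) \<le> F s - F t"
proof -
  have mv: "\<exists>c. a < c \<and> c < b \<and> F b - F a = (b - a) * f c" if "0 \<le> a" "a < b" for a b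
  proof -
    have "continuous_on {a..b} F" using radial_energy_continuous by (rule continuous_on_subset) (use that in auto)
    moreover have "F differentiable (at c)" if "a < c" for c
      using radial_energy_has_derivative[of c] that \<open>0 \<le> a\<close> real_differentiable_def by fastforce
    ultimately obtain l c where c: "a < c" "c < b" "(F has_real_derivative l) (at c)" "F b - F a = (b - a) * l"
      using MVT[of a b F] \<open>a < b\<close> by blast
    moreover have "l = f c" using c(3) radial_energy_has_derivative[of c] that c(1) by (auto intro: DERIV_unique)
    ultimately show ?thesis by blast
  qed
  consider "s = t" | "t < s" | "s < t" by linarith
  then show ?thesis
  proof cases
    case 2
    with mv[of t s] assms obtain c where c: "t < c" "F s - F t = (s - t) * f c" by auto
    then show ?thesis using 2 radial_flux_mono[of t c] assms by (simp add: mult.commute mult_left_mono)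
  next
    case 3
    with mv[of s t] assms obtain c where c: "s < c" "c < t" "F t - F s = (t - s) * f c" by auto
    then have "F t - F s \<le> (t - s) * f t" using 3 radial_flux_mono[of c t] assms by (simp add: mult_left_mono)
    then show ?thesis by (simp add: algebra_simps)
  qed simp
qed

text \<open>Cauchy-Schwarz reduces the inequality to the convexity of the radial profile, since \<open>f \<ge> 0\<close>.\<close>

lemma energy_density_subgradient:
  "flux p q \<mu> x \<xi> \<bullet> \<eta> \<le> energy_density p q \<mu> x (\<xi> + \<eta>) - energy_density p q \<mu> x \<xi>"
proof -
  have "sgn \<xi> \<bullet> (\<xi> + \<eta>) \<le> norm (sgn \<xi>) * norm (\<xi> + \<eta>)" by (rule norm_cauchy_schwarz)
  also have "\<dots> \<le> norm (\<xi> + \<eta>)" by (simp add: norm_sgn)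
  finally have "sgn \<xi> \<bullet> \<eta> \<le> norm (\<xi> + \<eta>) - norm \<xi>"
    by (cases "\<xi> = 0")
       (simp_all add: inner_add_right sgn_div_norm power2_norm_eq_inner[symmetric] power2_eq_square field_simps)
  then have "f (norm \<xi>) * (sgn \<xi> \<bullet> \<eta>) \<le> f (norm \<xi>) * (norm (\<xi> + \<eta>) - norm \<xi>)"
    using radial_flux_nonneg by (intro mult_left_mono) auto
  also have "\<dots> \<le> F (norm (\<xi> + \<eta>)) - F (norm \<xi>)" by (rule radial_energy_subgradient) auto
  finally show ?thesis by (simp add: flux_eq_radial energy_density_eq_radial)
qed

text \<open>The subgradient inequality at \<open>\<xi>\<close> bounds the remainder from below by zero, the one at \<open>\<xi> + \<eta>\<close> with increment \<open>- \<eta>\<close>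
bounds it from above by the monotonicity defect of the flux.\<close>

lemma energy_density_remainder:
  "\<bar>energy_density p q \<mu> x (\<xi> + \<eta>) - energy_density p q \<mu> x \<xi> - flux p q \<mu> x \<xi> \<bullet> \<eta>\<bar>
    \<le> norm (flux p q \<mu> x (\<xi> + \<eta>) - flux p q \<mu> x \<xi>) * norm \<eta>"
proof -
  have "energy_density p q \<mu> x (\<xi> + \<eta>) - energy_density p q \<mu> x \<xi> \<le> flux p q \<mu> x (\<xi> + \<eta>) \<bullet> \<eta>"
    using energy_density_subgradient[of "\<xi> + \<eta>" "- \<eta>"] by simp
  then have "energy_density p q \<mu> x (\<xi> + \<eta>) - energy_density p q \<mu> x \<xi> - flux p q \<mu> x \<xi> \<bullet> \<eta>
      \<le> (flux p q \<mu> x (\<xi> + \<eta>) - flux p q \<mu> x \<xi>) \<bullet> \<eta>"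
    by (simp add: inner_diff_left)
  also have "\<dots> \<le> norm (flux p q \<mu> x (\<xi> + \<eta>) - flux p q \<mu> x \<xi>) * norm \<eta>"
    by (rule norm_cauchy_schwarz)
  finally show ?thesis using energy_density_subgradient[of \<xi> \<eta>] by simp
qed

lemma energy_density_bounds:
  "0 \<le> energy_density p q \<mu> x \<xi>" "energy_density p q \<mu> x \<xi> \<le> H (norm \<xi>)"
proof -
  have l: "1 \<le> ln (exp 1 + norm \<xi>)" by (rule log_ge_1) simp
  then show "0 \<le> energy_density p q \<mu> x \<xi>"
    using weight exponent_bounds by (simp add: energy_density_def)
  have "norm \<xi> powr r / r \<le> norm \<xi> powr r" if "1 < r" for r
    using that mult_left_mono[of 1 r "norm \<xi> powr r"] by (simp add: divide_le_eq)
  then show "energy_density p q \<mu> x \<xi> \<le> H (norm \<xi>)"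
    unfolding energy_density_def H_log_def using l weight exponent_bounds
    by (intro add_mono mult_right_mono mult_left_mono) auto
qed

end

section \<open>Modulars and the continuity of the flux\<close>

locale log_modular =
  fixes M :: "'a::euclidean_space measure" and p q \<mu> :: "'a \<Rightarrow> real" and \<sigma> K :: real
  assumes measurable_data [measurable]:
      "p \<in> borel_measurable M" "q \<in> borel_measurable M" "\<mu> \<in> borel_measurable M"
    and bounds: "1 < \<sigma>" "1 < K"
    and growth: "AE x in M. growth_at p q \<mu> x \<sigma> K"
begin

text \<open>A real-valued counterpart of \<open>modular\<close>, for scalar and for vector fields, so that Bochner integrals can be used for
all estimates.\<close>

definition finite_modular :: "('a \<Rightarrow> 'b::euclidean_space) \<Rightarrow> bool" where
  "finite_modular g \<longleftrightarrow> g \<in> borel_measurable M \<and> integrable M (\<lambda>x. H_log p q \<mu> x (norm (g x)))"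

definition modular_value :: "('a \<Rightarrow> 'b::euclidean_space) \<Rightarrow> real" where
  "modular_value g = (LINT x|M. H_log p q \<mu> x (norm (g x)))"

lemma measurable_H_log [measurable (raw)]:
  fixes g :: "'a \<Rightarrow> 'b::euclidean_space"
  assumes [measurable]: "g \<in> borel_measurable M"
  shows "(\<lambda>x. H_log p q \<mu> x (norm (g x))) \<in> borel_measurable M"
  unfolding H_log_def by measurable

lemma measurable_integrands [measurable (raw)]:
  assumes [measurable]: "h \<in> borel_measurable M"
  shows "(\<lambda>x. energy_density p q \<mu> x (h x)) \<in> borel_measurable M"
    and "(\<lambda>x. p_flux p x (h x)) \<in> borel_measurable M"
    and "(\<lambda>x. flux p q \<mu> x (h x)) \<in> borel_measurable M"
  unfolding energy_density_def flux_def p_flux_def q_log_flux_def by measurable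

lemma finite_modularD:
  assumes "finite_modular g"
  shows "g \<in> borel_measurable M" "integrable M (\<lambda>x. H_log p q \<mu> x (norm (g x)))"
  using assms by (auto simp: finite_modular_def)

lemma finite_modularI:
  fixes g :: "'a \<Rightarrow> 'b::euclidean_space"
  assumes "g \<in> borel_measurable M" "integrable M w"
    and "\<And>x. growth_at p q \<mu> x \<sigma> K \<Longrightarrow> H_log p q \<mu> x (norm (g x)) \<le> w x"
  shows "finite_modular g"
  unfolding finite_modular_def
proof (intro conjI assms(1) Bochner_Integration.integrable_bound[OF assms(2)] measurable_H_log)
  show "AE x in M. norm (H_log p q \<mu> x (norm (g x))) \<le> norm (w x)"
    using growth
  proof eventually_elim
    case (elim x)
    then show ?case using assms(3)[OF elim] growth_at.H_nonneg[OF elim, of "norm (g x)"] by simp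
  qed
qed

lemma finite_modular_add:
  assumes g: "finite_modular g" and h: "finite_modular h"
  shows "finite_modular (\<lambda>x. g x + h x)"
proof (rule finite_modularI)
  show "integrable M (\<lambda>x. 2 powr (K + 1) * (H_log p q \<mu> x (norm (g x)) + H_log p q \<mu> x (norm (h x))))"
    using finite_modularD[OF g] finite_modularD[OF h] by simp
  fix x assume x: "growth_at p q \<mu> x \<sigma> K"
  have "H_log p q \<mu> x (norm (g x + h x)) \<le> H_log p q \<mu> x (norm (g x) + norm (h x))"
    by (rule growth_at.H_mono[OF x]) (auto intro: norm_triangle_ineq)
  then show "H_log p q \<mu> x (norm (g x + h x)) \<le> 2 powr (K + 1) * (H_log p q \<mu> x (norm (g x)) + H_log p q \<mu> x (norm (h x)))"
    using growth_at.H_add_le[OF x, of "norm (g x)" "norm (h x)"] by simp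
qed (use finite_modularD[OF g] finite_modularD[OF h] in auto)

lemma finite_modular_scale:
  assumes g: "finite_modular g"
  shows "finite_modular (\<lambda>x. c *\<^sub>R g x)"
proof (rule finite_modularI)
  show "integrable M (\<lambda>x. max 1 \<bar>c\<bar> powr (K + 1) * H_log p q \<mu> x (norm (g x)))"
    using finite_modularD[OF g] by simp
  fix x assume x: "growth_at p q \<mu> x \<sigma> K"
  have "H_log p q \<mu> x (norm (c *\<^sub>R g x)) \<le> H_log p q \<mu> x (max 1 \<bar>c\<bar> * norm (g x))"
    by (rule growth_at.H_mono[OF x]) (auto intro: mult_right_mono)
  then show "H_log p q \<mu> x (norm (c *\<^sub>R g x)) \<le> max 1 \<bar>c\<bar> powr (K + 1) * H_log p q \<mu> x (norm (g x))"
    using growth_at.H_dilation[OF x, of "max 1 \<bar>c\<bar>" "norm (g x)"] by simp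
qed (use finite_modularD[OF g] in auto)

lemma modular_value_nonneg: "0 \<le> modular_value g"
  unfolding modular_value_def using growth
  by (intro integral_nonneg_AE) (auto elim!: eventually_mono intro: growth_at.H_nonneg)

lemma modular_value_contraction:
  assumes g: "finite_modular g" and k: "0 < k" "k \<le> 1"
  shows "modular_value (\<lambda>x. k *\<^sub>R g x) \<le> k * modular_value g"
proof -
  have "k powr \<sigma> \<le> k" using powr_mono'[of 1 \<sigma> k] k bounds by simp
  have "modular_value (\<lambda>x. k *\<^sub>R g x) \<le> (LINT x|M. k * H_log p q \<mu> x (norm (g x)))"
    unfolding modular_value_def
  proof (rule integral_mono_AE)
    show "AE x in M. H_log p q \<mu> x (norm (k *\<^sub>R g x)) \<le> k * H_log p q \<mu> x (norm (g x))"
      using growth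
    proof eventually_elim
      case (elim x)
      have "H_log p q \<mu> x (norm (k *\<^sub>R g x)) \<le> k powr \<sigma> * H_log p q \<mu> x (norm (g x))"
        using growth_at.H_contraction[OF elim k, of "norm (g x)"] k by simp
      also have "\<dots> \<le> k * H_log p q \<mu> x (norm (g x))"
        using \<open>k powr \<sigma> \<le> k\<close> growth_at.H_nonneg[OF elim] by (intro mult_right_mono) auto
      finally show ?case .
    qed
  qed (use finite_modularD[OF g] finite_modularD[OF finite_modular_scale[OF g]] in auto)
  then show ?thesis by (simp add: modular_value_def)
qed

lemma integrable_energy_density:
  assumes g: "finite_modular g"
  shows "integrable M (\<lambda>x. energy_density p q \<mu> x (g x))"
proof (rule Bochner_Integration.integrable_bound[OF finite_modularD(2)[OF g]])
  show "AE x in M. norm (energy_density p q \<mu> x (g x)) \<le> norm (H_log p q \<mu> x (norm (g x)))"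
    using growth
  proof eventually_elim
    case (elim x)
    then show ?case
      using growth_at.energy_density_bounds[OF elim, of "g x"] by simp
  qed
qed (use finite_modularD[OF g] in measurable)

lemma integrable_pairing:
  assumes g: "finite_modular g" and h: "finite_modular h"
    and a: "a \<in> borel_measurable M"
    and a_le: "\<And>x. growth_at p q \<mu> x \<sigma> K \<Longrightarrow> norm (a x) \<le> radial_flux p q \<mu> x (norm (g x))"
  shows "integrable M (\<lambda>x. a x \<bullet> h x)" and "\<bar>LINT x|M. a x \<bullet> h x\<bar> \<le> 2 * modular_value g + 2 * modular_value h"
proof -
  let ?w = "\<lambda>x. 2 * H_log p q \<mu> x (norm (g x)) + 2 * H_log p q \<mu> x (norm (h x))"
  have w: "integrable M ?w"
    using finite_modularD[OF g] finite_modularD[OF h] by simp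
  have bound: "AE x in M. \<bar>a x \<bullet> h x\<bar> \<le> ?w x"
    using growth
  proof eventually_elim
    case (elim x)
    have "\<bar>a x \<bullet> h x\<bar> \<le> norm (a x) * norm (h x)" by (rule Cauchy_Schwarz_ineq2)
    also have "\<dots> \<le> radial_flux p q \<mu> x (norm (g x)) * norm (h x)"
      using a_le[OF elim] by (intro mult_right_mono) auto
    also have "\<dots> \<le> ?w x"
      using growth_at.young_radial_flux[OF elim, of "norm (g x)" "norm (h x)" 1] by simp
    finally show ?case .
  qed
  have meas: "(\<lambda>x. a x \<bullet> h x) \<in> borel_measurable M"
    using a finite_modularD(1)[OF h] by (rule borel_measurable_inner)
  show int: "integrable M (\<lambda>x. a x \<bullet> h x)"
    using bound by (intro Bochner_Integration.integrable_bound[OF w meas]) (auto elim!: eventually_mono)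
  have "\<bar>LINT x|M. a x \<bullet> h x\<bar> \<le> (LINT x|M. \<bar>a x \<bullet> h x\<bar>)"
    by (rule integral_abs_bound)
  also have "\<dots> \<le> (LINT x|M. ?w x)"
    using bound int w by (intro integral_mono_AE) auto
  also have "\<dots> = 2 * modular_value g + 2 * modular_value h"
    using finite_modularD[OF g] finite_modularD[OF h] by (simp add: modular_value_def)
  finally show "\<bar>LINT x|M. a x \<bullet> h x\<bar> \<le> 2 * modular_value g + 2 * modular_value h" .
qed

lemma flux_pairing:
  fixes g h :: "'a \<Rightarrow> 'a"
  assumes g: "finite_modular g" and h: "finite_modular h"
  shows "integrable M (\<lambda>x. p_flux p x (g x) \<bullet> h x)"
    and "integrable M (\<lambda>x. q_log_flux q \<mu> x (g x) \<bullet> h x)"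
    and "integrable M (\<lambda>x. flux p q \<mu> x (g x) \<bullet> h x)"
    and "\<bar>LINT x|M. flux p q \<mu> x (g x) \<bullet> h x\<bar> \<le> 2 * modular_value g + 2 * modular_value h"
proof -
  note [measurable] = finite_modularD(1)[OF g]
  show P: "integrable M (\<lambda>x. p_flux p x (g x) \<bullet> h x)"
    by (rule integrable_pairing[OF g h]) (auto intro: growth_at.p_flux_le)
  show F: "integrable M (\<lambda>x. flux p q \<mu> x (g x) \<bullet> h x)"
    and "\<bar>LINT x|M. flux p q \<mu> x (g x) \<bullet> h x\<bar> \<le> 2 * modular_value g + 2 * modular_value h"
    by (rule integrable_pairing[OF g h]; simp add: growth_at.norm_flux_eq)+
  show "integrable M (\<lambda>x. q_log_flux q \<mu> x (g x) \<bullet> h x)"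
    using Bochner_Integration.integrable_diff[OF F P] by (simp add: flux_def inner_add_left)
qed

text \<open>The core of the proof: the superposition operator of the flux is continuous, uniformly over the test fields in
the unit ball of the modular. Integrating \<open>flux_oscillation\<close> and \<open>young_radial_flux\<close> gives
\<open>2 \<omega>(\<tau>) (rho(g) + 1) + C(\<tau>) (2 k powr (\<sigma> - 1) + 2 \<delta> / k)\<close> as a bound, where \<open>rho\<close> stands for \<open>modular_value\<close>; each of the three
terms is made at most \<open>\<epsilon> / 3\<close>, by the choice of \<open>\<tau>\<close>, then of \<open>k\<close>, then of \<open>\<delta>\<close>.\<close>

lemma flux_continuity:
  fixes g :: "'a \<Rightarrow> 'a"
  assumes g: "finite_modular g" and \<epsilon>: "0 < \<epsilon>"
  obtains \<delta> where "0 < \<delta>"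
    and "\<And>\<eta> \<zeta> :: 'a \<Rightarrow> 'a. finite_modular \<eta> \<Longrightarrow> finite_modular \<zeta> \<Longrightarrow> modular_value \<eta> \<le> \<delta> \<Longrightarrow> modular_value \<zeta> \<le> 1 \<Longrightarrow>
      integrable M (\<lambda>x. norm (flux p q \<mu> x (g x + \<eta> x) - flux p q \<mu> x (g x)) * norm (\<zeta> x)) \<and>
      (LINT x|M. norm (flux p q \<mu> x (g x + \<eta> x) - flux p q \<mu> x (g x)) * norm (\<zeta> x)) \<le> \<epsilon>"
proof -
  define \<omega> where "\<omega> \<tau> = (1 + \<tau>) powr K - (1 - \<tau>) powr K + 2 * \<tau>" for \<tau> :: real
  have "((\<lambda>\<tau>. 2 * \<omega> \<tau> * (modular_value g + 1)) \<longlongrightarrow> 2 * ((1 + 0) powr K - (1 - 0) powr K + 2 * 0) * (modular_value g + 1)) (at_right 0)"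
    unfolding \<omega>_def by (intro tendsto_intros) auto
  then have "\<forall>\<^sub>F \<tau> in at_right 0. 2 * \<omega> \<tau> * (modular_value g + 1) < \<epsilon> / 3"
    using \<epsilon> by (intro order_tendstoD) auto
  moreover have "\<forall>\<^sub>F \<tau>::real in at_right 0. 0 < \<tau> \<and> \<tau> < 1"
    by (auto simp: eventually_at_right_field intro!: exI[of _ 1])
  ultimately have "\<forall>\<^sub>F \<tau> in at_right 0. 2 * \<omega> \<tau> * (modular_value g + 1) < \<epsilon> / 3 \<and> 0 < \<tau> \<and> \<tau> < 1"
    by eventually_elim auto
  then obtain \<tau> where \<tau>: "0 < \<tau>" "\<tau> < 1" "2 * \<omega> \<tau> * (modular_value g + 1) < \<epsilon> / 3"
    using eventually_happens'[OF trivial_limit_at_right_real] by blast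
  define C where "C = 2 * (1 + 1 / \<tau>) powr K"
  have "0 < 1 + 1 / \<tau>" using \<tau> by (simp add: add_pos_pos)
  then have C: "0 < C" by (simp add: C_def)
  have \<omega>: "0 \<le> \<omega> \<tau>" using \<tau> bounds by (simp add: \<omega>_def powr_mono2)
  have "((\<lambda>k. C * (2 * k powr (\<sigma> - 1))) \<longlongrightarrow> C * (2 * 0)) (at_right 0)"
    using bounds by (intro tendsto_intros tendsto_zero_powrI[where b = "\<sigma> - 1"] tendsto_const)
      (auto simp: eventually_at_right_field intro!: exI[of _ 1])
  then have "\<forall>\<^sub>F k in at_right 0. C * (2 * k powr (\<sigma> - 1)) < \<epsilon> / 3"
    using \<epsilon> by (intro order_tendstoD) auto
  moreover have "\<forall>\<^sub>F k::real in at_right 0. 0 < k \<and> k < 1"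
    by (auto simp: eventually_at_right_field intro!: exI[of _ 1])
  ultimately have "\<forall>\<^sub>F k in at_right 0. C * (2 * k powr (\<sigma> - 1)) < \<epsilon> / 3 \<and> 0 < k \<and> k < 1"
    by eventually_elim auto
  then obtain k where k: "0 < k" "k < 1" "C * (2 * k powr (\<sigma> - 1)) < \<epsilon> / 3"
    using eventually_happens'[OF trivial_limit_at_right_real] by blast
  define \<delta> where "\<delta> = \<epsilon> * k / (6 * C)"
  show thesis
  proof (rule that)
    show "0 < \<delta>" using \<epsilon> k C by (simp add: \<delta>_def)
    fix \<eta> \<zeta> :: "'a \<Rightarrow> 'a"
    assume \<eta>: "finite_modular \<eta>" "modular_value \<eta> \<le> \<delta>" and \<zeta>: "finite_modular \<zeta>" "modular_value \<zeta> \<le> 1"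
    note [measurable] = finite_modularD(1)[OF g] finite_modularD(1)[OF \<eta>(1)] finite_modularD(1)[OF \<zeta>(1)]
    let ?d = "\<lambda>x. norm (flux p q \<mu> x (g x + \<eta> x) - flux p q \<mu> x (g x)) * norm (\<zeta> x)"
    let ?H = "\<lambda>w x. H_log p q \<mu> x (norm (w x :: 'a))"
    let ?w = "\<lambda>x. \<omega> \<tau> * (2 * ?H g x + 2 * ?H \<zeta> x) + C * (2 / k * ?H \<eta> x + 2 * k powr (\<sigma> - 1) * ?H \<zeta> x)"
    have bound: "AE x in M. ?d x \<le> ?w x"
      using growth
    proof eventually_elim
      case (elim x)
      let ?f = "radial_flux p q \<mu> x"
      have "?d x \<le> (\<omega> \<tau> * ?f (norm (g x)) + C * ?f (norm (\<eta> x))) * norm (\<zeta> x)"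
        unfolding \<omega>_def C_def
        by (intro mult_right_mono growth_at.flux_oscillation[OF elim] \<tau>) auto
      also have "\<dots> = \<omega> \<tau> * (?f (norm (g x)) * norm (\<zeta> x)) + C * (?f (norm (\<eta> x)) * norm (\<zeta> x))"
        by (simp add: algebra_simps)
      also have "\<dots> \<le> ?w x"
      proof (intro add_mono mult_left_mono)
        show "?f (norm (g x)) * norm (\<zeta> x) \<le> 2 * ?H g x + 2 * ?H \<zeta> x"
          using growth_at.young_radial_flux[OF elim, of "norm (g x)" "norm (\<zeta> x)" 1] by simp
        show "?f (norm (\<eta> x)) * norm (\<zeta> x) \<le> 2 / k * ?H \<eta> x + 2 * k powr (\<sigma> - 1) * ?H \<zeta> x"
          using growth_at.young_radial_flux[OF elim, of "norm (\<eta> x)" "norm (\<zeta> x)" k] k by simp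
      qed (use \<omega> C in auto)
      finally show ?case .
    qed
    note ints = finite_modularD(2)[OF g] finite_modularD(2)[OF \<eta>(1)] finite_modularD(2)[OF \<zeta>(1)]
    have w: "integrable M ?w" using ints by simp
    have "?d \<in> borel_measurable M" by measurable
    then have int: "integrable M ?d"
      using bound by (intro Bochner_Integration.integrable_bound[OF w]) (auto elim!: eventually_mono)
    have "(LINT x|M. ?d x) \<le> (LINT x|M. ?w x)"
      by (rule integral_mono_AE[OF int w bound])
    also have "\<dots> = \<omega> \<tau> * (2 * modular_value g + 2 * modular_value \<zeta>) + C * (2 / k * modular_value \<eta> + 2 * k powr (\<sigma> - 1) * modular_value \<zeta>)"
      using ints by (simp add: modular_value_def)
    also have "\<dots> \<le> \<omega> \<tau> * (2 * modular_value g + 2 * 1) + C * (2 / k * \<delta> + 2 * k powr (\<sigma> - 1) * 1)"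
      using \<omega> C k \<eta>(2) \<zeta>(2) by (intro add_mono mult_left_mono) auto
    also have "\<dots> = 2 * \<omega> \<tau> * (modular_value g + 1) + C * (2 * k powr (\<sigma> - 1)) + C * (2 / k * \<delta>)"
      by (simp add: algebra_simps)
    also have "C * (2 / k * \<delta>) = \<epsilon> / 3" using C k by (simp add: \<delta>_def field_simps)
    also have "2 * \<omega> \<tau> * (modular_value g + 1) + C * (2 * k powr (\<sigma> - 1)) + \<epsilon> / 3 \<le> \<epsilon>"
      using \<tau>(3) k(3) by simp
    finally show "integrable M ?d \<and> (LINT x|M. ?d x) \<le> \<epsilon>" using int by blast
  qed
qed

end

section \<open>The Sobolev space and the energy functional\<close>

locale log_sobolev = log_modular "lebesgue_on \<Omega>" p q \<mu> \<sigma> K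
  for \<Omega> :: "'a::euclidean_space set" and p q \<mu> :: "'a \<Rightarrow> real" and \<sigma> K :: real +
  assumes open_domain: "open \<Omega>"
begin

abbreviation "grad \<equiv> weak_gradient \<Omega>"
abbreviation "W1 \<equiv> W1_Hlog \<Omega> p q \<mu>"
abbreviation "N \<equiv> norm_W1 \<Omega> p q \<mu>"

lemma modular_eq_modular_value:
  assumes "finite_modular w"
  shows "modular \<Omega> p q \<mu> w = ennreal (modular_value w)"
proof -
  have "AE x in lebesgue_on \<Omega>. 0 \<le> H_log p q \<mu> x (norm (w x))"
    using growth by (auto elim!: eventually_mono intro: growth_at.H_nonneg)
  then show ?thesis
    using finite_modularD(2)[OF assms] by (simp add: modular_def modular_value_def nn_integral_eq_integral)
qed

lemma finite_modular_iff_L_Hlog: "finite_modular w \<longleftrightarrow> w \<in> L_Hlog \<Omega> p q \<mu>"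
proof
  assume w: "finite_modular w"
  then show "w \<in> L_Hlog \<Omega> p q \<mu>"
    using finite_modularD(1)[OF w] modular_eq_modular_value[OF w] by (simp add: L_Hlog_def)
next
  assume w: "w \<in> L_Hlog \<Omega> p q \<mu>"
  then have [measurable]: "w \<in> borel_measurable (lebesgue_on \<Omega>)" by (simp add: L_Hlog_def)
  have "AE x in lebesgue_on \<Omega>. 0 \<le> H_log p q \<mu> x (norm (w x))"
    using growth by (auto elim!: eventually_mono intro: growth_at.H_nonneg)
  moreover have "(\<lambda>x. H_log p q \<mu> x (norm (w x))) \<in> borel_measurable (lebesgue_on \<Omega>)" by measurable
  ultimately have "integrable (lebesgue_on \<Omega>) (\<lambda>x. H_log p q \<mu> x (norm (w x)))"
    using w by (intro integrableI_nonneg) (auto simp: L_Hlog_def modular_def)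
  then show "finite_modular w" by (simp add: finite_modular_def)
qed

lemma modular_value_norm: "modular_value (\<lambda>x. norm (g x)) = modular_value g"
  by (simp add: modular_value_def)

lemma finite_modular_norm:
  "g \<in> borel_measurable (lebesgue_on \<Omega>) \<Longrightarrow> finite_modular (\<lambda>x. norm (g x)) \<longleftrightarrow> finite_modular g"
  by (auto simp: finite_modular_def)

lemma finite_modular_cong_AE:
  assumes g: "finite_modular g" and h: "h \<in> borel_measurable (lebesgue_on \<Omega>)"
    and eq: "AE x in lebesgue_on \<Omega>. h x = g x"
  shows "finite_modular h" and "modular_value h = modular_value g"
proof -
  note [measurable] = h finite_modularD(1)[OF g]
  have eq': "AE x in lebesgue_on \<Omega>. H_log p q \<mu> x (norm (g x)) = H_log p q \<mu> x (norm (h x))"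
    using eq by eventually_elim simp
  show "finite_modular h"
    unfolding finite_modular_def
    by (intro conjI h integrable_cong_AE_imp[OF finite_modularD(2)[OF g] _ eq']) measurable
  show "modular_value h = modular_value g"
    unfolding modular_value_def using eq' by (intro integral_cong_AE) auto
qed

lemma grad_measurable: "weakly_differentiable \<Omega> u \<Longrightarrow> grad u \<in> borel_measurable (lebesgue_on \<Omega>)"
  using weak_gradient_is_weak_gradient[of \<Omega> u] open_domain
  by (auto simp: is_weak_gradient_def intro: borel_measurable_if_locally_integrable)

lemma W1_iff:
  "u \<in> W1 \<longleftrightarrow> finite_modular u \<and> weakly_differentiable \<Omega> u \<and> finite_modular (grad u)"
  using grad_measurable[of u] finite_modular_norm[of "grad u"]
  by (auto simp: W1_Hlog_def finite_modular_iff_L_Hlog)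

lemma W1D:
  assumes "u \<in> W1"
  shows "finite_modular u" "weakly_differentiable \<Omega> u" "finite_modular (grad u)"
    "grad u \<in> borel_measurable (lebesgue_on \<Omega>)"
  using assms by (auto simp: W1_iff grad_measurable)

lemma W1I:
  assumes "finite_modular u" "is_weak_gradient \<Omega> u g" "finite_modular g"
  shows "u \<in> W1"
proof -
  have wd: "weakly_differentiable \<Omega> u" using assms(2) by (auto simp: weakly_differentiable_def)
  show ?thesis
    using assms wd finite_modular_cong_AE(1)[OF assms(3) grad_measurable[OF wd] weak_gradient_AE_eq[OF open_domain assms(2)]]
    by (simp add: W1_iff)
qed

lemma
  assumes u: "u \<in> W1" and v: "v \<in> W1"
  shows W1_add: "(\<lambda>x. u x + v x) \<in> W1"
    and grad_add: "AE x in lebesgue_on \<Omega>. grad (\<lambda>x. u x + v x) x = grad u x + grad v x"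
proof -
  have g: "is_weak_gradient \<Omega> (\<lambda>x. u x + v x) (\<lambda>x. grad u x + grad v x)"
    using W1D(2)[OF u] W1D(2)[OF v]
    by (intro is_weak_gradient_add open_domain weak_gradient_is_weak_gradient)
  show "(\<lambda>x. u x + v x) \<in> W1"
    by (rule W1I[OF _ g]) (use W1D[OF u] W1D[OF v] in \<open>auto intro: finite_modular_add\<close>)
  show "AE x in lebesgue_on \<Omega>. grad (\<lambda>x. u x + v x) x = grad u x + grad v x"
    by (rule weak_gradient_AE_eq[OF open_domain g])
qed

lemma
  assumes u: "u \<in> W1"
  shows W1_scale: "(\<lambda>x. c * u x) \<in> W1"
    and grad_scale: "AE x in lebesgue_on \<Omega>. grad (\<lambda>x. c * u x) x = c *\<^sub>R grad u x"
proof -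
  have g: "is_weak_gradient \<Omega> (\<lambda>x. c * u x) (\<lambda>x. c *\<^sub>R grad u x)"
    using W1D(2)[OF u] by (intro is_weak_gradient_scale weak_gradient_is_weak_gradient)
  show "(\<lambda>x. c * u x) \<in> W1"
    by (rule W1I[OF _ g])
      (use W1D[OF u] finite_modular_scale[of u c] in \<open>auto intro: finite_modular_scale\<close>)
  show "AE x in lebesgue_on \<Omega>. grad (\<lambda>x. c * u x) x = c *\<^sub>R grad u x"
    by (rule weak_gradient_AE_eq[OF open_domain g])
qed

lemma
  assumes u: "u \<in> W1" and v: "v \<in> W1"
  shows W1_diff: "(\<lambda>x. u x - v x) \<in> W1"
    and grad_diff: "AE x in lebesgue_on \<Omega>. grad (\<lambda>x. u x - v x) x = grad u x - grad v x"
proof -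
  have eq: "(\<lambda>x. u x - v x) = (\<lambda>x. u x + (- 1) * v x)" by simp
  show "(\<lambda>x. u x - v x) \<in> W1"
    unfolding eq by (intro W1_add W1_scale u v)
  show "AE x in lebesgue_on \<Omega>. grad (\<lambda>x. u x - v x) x = grad u x - grad v x"
    unfolding eq using grad_add[OF u W1_scale[OF v, of "- 1"]] grad_scale[OF v, of "- 1"]
    by eventually_elim simp
qed

lemma zero_in_W1: "(\<lambda>x. 0) \<in> W1"
  and grad_zero: "AE x in lebesgue_on \<Omega>. grad (\<lambda>x. 0) x = 0"
proof -
  have g: "is_weak_gradient \<Omega> (\<lambda>x. 0) (\<lambda>x. 0)"
    by (simp add: is_weak_gradient_def locally_integrable_def)
  show "(\<lambda>x. 0) \<in> W1" by (intro W1I[OF _ g]) (simp_all add: finite_modular_def H_log_def)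
  show "AE x in lebesgue_on \<Omega>. grad (\<lambda>x. 0) x = 0"
    by (rule weak_gradient_AE_eq[OF open_domain g])
qed

definition gauge_scales :: "('a \<Rightarrow> real) \<Rightarrow> real set" where
  "gauge_scales u = {s. 0 < s \<and> modular \<Omega> p q \<mu> (\<lambda>x. u x / s) +
     modular \<Omega> p q \<mu> (\<lambda>x. norm (grad u x) / s) \<le> 1}"

lemma norm_eq_Inf_gauge: "N u = Inf (gauge_scales u)"
  by (simp add: norm_W1_def gauge_scales_def)

lemma gauge_scales_iff:
  assumes u: "u \<in> W1" and s: "0 < s"
  shows "s \<in> gauge_scales u \<longleftrightarrow> modular_value (\<lambda>x. (1 / s) *\<^sub>R u x) + modular_value (\<lambda>x. (1 / s) *\<^sub>R grad u x) \<le> 1"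
proof -
  have 1: "modular \<Omega> p q \<mu> (\<lambda>x. u x / s) = ennreal (modular_value (\<lambda>x. (1 / s) *\<^sub>R u x))"
    using modular_eq_modular_value[OF finite_modular_scale[OF W1D(1)[OF u], of "1 / s"]] by simp
  have fin: "finite_modular (\<lambda>x. norm ((1 / s) *\<^sub>R grad u x))"
    using finite_modular_scale[OF W1D(3)[OF u], of "1 / s"] W1D(4)[OF u] by (subst finite_modular_norm) auto
  have eq: "(\<lambda>x. norm ((1 / s) *\<^sub>R grad u x)) = (\<lambda>x. norm (grad u x) / s)"
    using s by (simp add: fun_eq_iff)
  have 2: "modular \<Omega> p q \<mu> (\<lambda>x. norm (grad u x) / s) = ennreal (modular_value (\<lambda>x. (1 / s) *\<^sub>R grad u x))"
    using modular_eq_modular_value[OF fin] modular_value_norm[of "\<lambda>x. (1 / s) *\<^sub>R grad u x"] unfolding eq by simp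
  have "ennreal (modular_value (\<lambda>x. (1 / s) *\<^sub>R u x)) + ennreal (modular_value (\<lambda>x. (1 / s) *\<^sub>R grad u x)) \<le> 1 \<longleftrightarrow>
      modular_value (\<lambda>x. (1 / s) *\<^sub>R u x) + modular_value (\<lambda>x. (1 / s) *\<^sub>R grad u x) \<le> 1"
    by (simp add: modular_value_nonneg flip: ennreal_plus ennreal_1)
  then show ?thesis using s by (simp add: gauge_scales_def 1 2)
qed

text \<open>Without this the norm would be the infimum of the empty set, which carries no information. The modular is finite and
contracts at least linearly, so division of \<open>u\<close> by a scale that is at least one and at least the modular brings it down to one.\<close>

lemma gauge_scales_nonempty:
  assumes u: "u \<in> W1" shows "gauge_scales u \<noteq> {}"
proof -
  define s where "s = max 1 (modular_value u + modular_value (grad u))"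
  have s: "0 < s" "0 < 1 / s" "1 / s \<le> 1" by (auto simp: s_def)
  have "modular_value (\<lambda>x. (1 / s) *\<^sub>R u x) + modular_value (\<lambda>x. (1 / s) *\<^sub>R grad u x) \<le> 1 / s * modular_value u + 1 / s * modular_value (grad u)"
    using W1D[OF u] s by (intro add_mono modular_value_contraction)
  also have "\<dots> = (modular_value u + modular_value (grad u)) / s" by (simp add: add_divide_distrib)
  also have "\<dots> \<le> 1" using s by (simp add: s_def divide_le_eq)
  finally have "s \<in> gauge_scales u" using gauge_scales_iff[OF u s(1)] by simp
  then show ?thesis by blast
qed

lemma gauge_scales_bdd_below: "bdd_below (gauge_scales u)"
  by (rule bdd_belowI[of _ 0]) (simp add: gauge_scales_def)

lemma gauge_scale_below:
  assumes u: "u \<in> W1" and less: "N u < d"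
  obtains s where "0 < s" "s < d" "modular_value (\<lambda>x. (1 / s) *\<^sub>R grad u x) \<le> 1"
proof -
  obtain s where s: "s \<in> gauge_scales u" "s < d"
    using less cInf_less_iff[OF gauge_scales_nonempty[OF u] gauge_scales_bdd_below] by (auto simp: norm_eq_Inf_gauge)
  then have "0 < s" by (simp add: gauge_scales_def)
  moreover from this have "modular_value (\<lambda>x. (1 / s) *\<^sub>R grad u x) \<le> 1"
    using s(1) gauge_scales_iff[OF u] modular_value_nonneg[of "\<lambda>x. (1 / s) *\<^sub>R u x"] by fastforce
  ultimately show thesis using s(2) that by blast
qed

text \<open>Bounds for the norm are proved for the admissible scales \<open>s\<close>, where the modular is available, and pass to the infimum.
It suffices to consider scales below some \<open>d\<close> larger than the norm. When the norm
vanishes, this shows that \<open>A \<le> 0\<close>.\<close>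

lemma le_norm_if_le_scales:
  assumes u: "u \<in> W1" and C: "0 \<le> C" and less: "N u < d"
    and le: "\<And>s. 0 < s \<Longrightarrow> s < d \<Longrightarrow> modular_value (\<lambda>x. (1 / s) *\<^sub>R grad u x) \<le> 1 \<Longrightarrow> A \<le> C * s"
  shows "A \<le> C * N u"
proof (rule field_le_epsilon)
  fix e :: real assume e: "0 < e"
  then have "N u < min d (N u + e / (C + 1))" using less C by simp
  then obtain s where s: "0 < s" "s < min d (N u + e / (C + 1))" "modular_value (\<lambda>x. (1 / s) *\<^sub>R grad u x) \<le> 1"
    using gauge_scale_below[OF u] by metis
  then have "A \<le> C * s" using le by simp
  also have "\<dots> \<le> C * (N u + e / (C + 1))" using s C by (intro mult_left_mono) auto
  also have "\<dots> = C * N u + C / (C + 1) * e" by (simp add: distrib_left)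
  also have "C / (C + 1) * e \<le> 1 * e" using C e by (intro mult_right_mono) auto
  finally show "A \<le> C * N u + e" by simp
qed

text \<open>Convexity of the modular turns smallness of the norm into smallness of the modular.\<close>

lemma modular_value_le_scale:
  assumes g: "finite_modular g" and s: "0 < s" "s \<le> 1" "modular_value (\<lambda>x. (1 / s) *\<^sub>R g x) \<le> 1"
  shows "modular_value g \<le> s"
proof -
  have "modular_value (\<lambda>x. s *\<^sub>R (1 / s) *\<^sub>R g x) \<le> s * modular_value (\<lambda>x. (1 / s) *\<^sub>R g x)"
    using s by (intro modular_value_contraction finite_modular_scale g)
  also have "\<dots> \<le> s * 1" using s by (intro mult_left_mono) auto
  finally show ?thesis using s by simp
qed

lemma log_operator_eq:
  assumes u: "u \<in> W1" and v: "v \<in> W1"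
  shows "log_operator \<Omega> p q \<mu> u v = (LINT x|lebesgue_on \<Omega>. flux p q \<mu> x (grad u x) \<bullet> grad v x)"
  using flux_pairing(1,2)[OF W1D(3)[OF u] W1D(3)[OF v]]
  by (simp add: log_operator_def flux_def inner_add_left)

text \<open>At an admissible scale \<open>s\<close> of \<open>v\<close> the gradient of \<open>v\<close> is \<open>s\<close> times a field of modular at most one, so Young's
inequality with \<open>k = 1\<close> bounds the pairing by \<open>s\<close> times a constant that depends on \<open>u\<close> only.\<close>

lemma log_operator_in_dual:
  assumes V: "V \<subseteq> W1" and u: "u \<in> W1"
  shows "log_operator \<Omega> p q \<mu> u \<in> dual_space V N"
  unfolding dual_space_def
proof (intro CollectI conjI ballI allI)
  note [measurable] = W1D(4)[OF u]
  let ?a = "\<lambda>x. flux p q \<mu> x (grad u x)"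
  fix v assume "v \<in> V"
  then have v: "v \<in> W1" using V by auto
  note [measurable] = W1D(4)[OF v]
  note iv = flux_pairing(3)[OF W1D(3)[OF u] W1D(3)[OF v]]
  show "log_operator \<Omega> p q \<mu> u (\<lambda>x. c * v x) = c * log_operator \<Omega> p q \<mu> u v" for c
  proof -
    note [measurable] = W1D(4)[OF W1_scale[OF v, of c]]
    have "(LINT x|lebesgue_on \<Omega>. ?a x \<bullet> grad (\<lambda>x. c * v x) x) = (LINT x|lebesgue_on \<Omega>. c * (?a x \<bullet> grad v x))"
      using grad_scale[OF v, of c] by (intro integral_cong_AE) (measurable, auto elim!: eventually_mono)
    then show ?thesis using W1_scale[OF v] u v by (simp add: log_operator_eq)
  qed
  fix w assume "w \<in> V"
  then have w: "w \<in> W1" using V by auto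
  note [measurable] = W1D(4)[OF w] W1D(4)[OF W1_add[OF v w]]
  note iw = flux_pairing(3)[OF W1D(3)[OF u] W1D(3)[OF w]]
  have "(LINT x|lebesgue_on \<Omega>. ?a x \<bullet> grad (\<lambda>x. v x + w x) x) =
      (LINT x|lebesgue_on \<Omega>. ?a x \<bullet> grad v x + ?a x \<bullet> grad w x)"
    using grad_add[OF v w] by (intro integral_cong_AE) (measurable, auto elim!: eventually_mono simp: inner_add_right)
  then show "log_operator \<Omega> p q \<mu> u (\<lambda>x. v x + w x) = log_operator \<Omega> p q \<mu> u v + log_operator \<Omega> p q \<mu> u w"
    using W1_add[OF v w] u v w iv iw by (simp add: log_operator_eq)
next
  let ?C = "2 * modular_value (grad u) + 2"
  show "\<exists>C. \<forall>v\<in>V. \<bar>log_operator \<Omega> p q \<mu> u v\<bar> \<le> C * N v"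
  proof (intro exI ballI)
    fix v assume "v \<in> V"
    then have v: "v \<in> W1" using V by auto
    show "\<bar>log_operator \<Omega> p q \<mu> u v\<bar> \<le> ?C * N v"
    proof (rule le_norm_if_le_scales[OF v, where d = "N v + 1"])
      fix s :: real assume s: "0 < s" "modular_value (\<lambda>x. (1 / s) *\<^sub>R grad v x) \<le> 1"
      have "log_operator \<Omega> p q \<mu> u v = s * (LINT x|lebesgue_on \<Omega>. flux p q \<mu> x (grad u x) \<bullet> (1 / s) *\<^sub>R grad v x)"
        using s u v by (simp add: log_operator_eq)
      also have "\<bar>\<dots>\<bar> \<le> s * ?C"
        using flux_pairing(4)[OF W1D(3)[OF u] finite_modular_scale[OF W1D(3)[OF v]], of "1 / s"] s
        by (simp only: abs_mult) (intro mult_mono, auto)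
      finally show "\<bar>log_operator \<Omega> p q \<mu> u v\<bar> \<le> ?C * s" by (simp add: mult.commute)
    qed (use modular_value_nonneg[of "grad u"] in auto)
  qed
qed

text \<open>At an admissible scale \<open>s\<close> of \<open>h\<close> the pointwise remainder is at most \<open>|a(\<nabla>u + \<nabla>h) - a(\<nabla>u)| |\<nabla>h|\<close>. Here
\<open>\<nabla>h\<close> plays both roles of \<open>flux_continuity\<close>: as increment it has modular at most \<open>s\<close>, and after division by \<open>s\<close>
it is a test field of modular at most one.\<close>

lemma energy_frechet_derivative:
  assumes V: "V \<subseteq> W1" and u: "u \<in> W1"
  shows "frechet_derivative_at V N (energy \<Omega> p q \<mu>) u (log_operator \<Omega> p q \<mu> u)"
  unfolding frechet_derivative_at_def
proof (intro conjI log_operator_in_dual[OF V u] allI impI)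
  fix \<epsilon> :: real assume \<epsilon>: "0 < \<epsilon>"
  let ?a = "flux p q \<mu>" and ?\<Phi> = "energy_density p q \<mu>"
  obtain \<delta> where \<delta>: "0 < \<delta>" and cont: "\<And>\<eta> \<zeta> :: 'a \<Rightarrow> 'a. finite_modular \<eta> \<Longrightarrow> finite_modular \<zeta> \<Longrightarrow>
      modular_value \<eta> \<le> \<delta> \<Longrightarrow> modular_value \<zeta> \<le> 1 \<Longrightarrow>
      integrable (lebesgue_on \<Omega>) (\<lambda>x. norm (?a x (grad u x + \<eta> x) - ?a x (grad u x)) * norm (\<zeta> x)) \<and>
      (LINT x|lebesgue_on \<Omega>. norm (?a x (grad u x + \<eta> x) - ?a x (grad u x)) * norm (\<zeta> x)) \<le> \<epsilon>"
    using flux_continuity[OF W1D(3)[OF u] \<epsilon>] by blast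
  show "\<exists>\<delta>>0. \<forall>h\<in>V. N h < \<delta> \<longrightarrow>
      \<bar>energy \<Omega> p q \<mu> (\<lambda>x. u x + h x) - energy \<Omega> p q \<mu> u - log_operator \<Omega> p q \<mu> u h\<bar> \<le> \<epsilon> * N h"
  proof (intro exI[of _ "min 1 \<delta>"] conjI ballI impI)
    show "0 < min 1 \<delta>" using \<delta> by simp
    fix h assume "h \<in> V" and Nh: "N h < min 1 \<delta>"
    then have h: "h \<in> W1" using V by auto
    note [measurable] = W1D(4)[OF u] W1D(4)[OF h] W1D(4)[OF W1_add[OF u h]]
    let ?R = "\<lambda>x. ?\<Phi> x (grad u x + grad h x) - ?\<Phi> x (grad u x) - ?a x (grad u x) \<bullet> grad h x"
    have ints: "integrable (lebesgue_on \<Omega>) (\<lambda>x. ?\<Phi> x (grad u x + grad h x))"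
      "integrable (lebesgue_on \<Omega>) (\<lambda>x. ?\<Phi> x (grad u x))"
      "integrable (lebesgue_on \<Omega>) (\<lambda>x. ?a x (grad u x) \<bullet> grad h x)"
      by (intro integrable_energy_density finite_modular_add W1D flux_pairing u h)+
    have "energy \<Omega> p q \<mu> (\<lambda>x. u x + h x) = (LINT x|lebesgue_on \<Omega>. ?\<Phi> x (grad u x + grad h x))"
      unfolding energy_def using grad_add[OF u h]
      by (intro integral_cong_AE) (measurable, auto elim!: eventually_mono)
    then have R: "energy \<Omega> p q \<mu> (\<lambda>x. u x + h x) - energy \<Omega> p q \<mu> u - log_operator \<Omega> p q \<mu> u h
        = (LINT x|lebesgue_on \<Omega>. ?R x)"
      using ints u h by (simp add: energy_def log_operator_eq)
    show "\<bar>energy \<Omega> p q \<mu> (\<lambda>x. u x + h x) - energy \<Omega> p q \<mu> u - log_operator \<Omega> p q \<mu> u h\<bar> \<le> \<epsilon> * N h"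
      unfolding R
    proof (rule le_norm_if_le_scales[OF h _ Nh])
      fix s :: real assume s: "0 < s" "s < min 1 \<delta>" "modular_value (\<lambda>x. (1 / s) *\<^sub>R grad h x) \<le> 1"
      let ?\<zeta> = "\<lambda>x. (1 / s) *\<^sub>R grad h x"
      let ?d = "\<lambda>x. norm (?a x (grad u x + grad h x) - ?a x (grad u x)) * norm (?\<zeta> x)"
      have "modular_value (grad h) \<le> \<delta>"
        using modular_value_le_scale[OF W1D(3)[OF h] s(1) _ s(3)] s by simp
      from cont[OF W1D(3)[OF h] finite_modular_scale[OF W1D(3)[OF h]] this s(3)]
      have d: "integrable (lebesgue_on \<Omega>) ?d" "(LINT x|lebesgue_on \<Omega>. ?d x) \<le> \<epsilon>" by auto
      have "\<bar>LINT x|lebesgue_on \<Omega>. ?R x\<bar> \<le> (LINT x|lebesgue_on \<Omega>. \<bar>?R x\<bar>)"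
        by (rule integral_abs_bound)
      also have "\<dots> \<le> (LINT x|lebesgue_on \<Omega>. s * ?d x)"
      proof (rule integral_mono_AE)
        show "AE x in lebesgue_on \<Omega>. \<bar>?R x\<bar> \<le> s * ?d x"
          using growth
        proof eventually_elim
          case (elim x)
          then show ?case
            using growth_at.energy_density_remainder[OF elim, of "grad u x" "grad h x"] s by simp
        qed
        show "integrable (lebesgue_on \<Omega>) (\<lambda>x. s * ?d x)" by (rule integrable_mult_right) (rule d(1))
      qed (use ints in auto)
      also have "\<dots> = s * (LINT x|lebesgue_on \<Omega>. ?d x)" by (rule integral_mult_right_zero)
      also have "\<dots> \<le> s * \<epsilon>" using d s by (intro mult_left_mono) auto
      finally show "\<bar>LINT x|lebesgue_on \<Omega>. ?R x\<bar> \<le> \<epsilon> * s" by (simp add: mult.commute)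
    qed (use \<epsilon> in auto)
  qed
qed

text \<open>The case \<open>\<eta> = \<nabla>w - \<nabla>u\<close> of \<open>flux_continuity\<close>, with \<open>\<zeta>\<close> the gradient of \<open>v\<close> divided by an admissible scale of \<open>v\<close>.\<close>

lemma log_operator_continuous:
  assumes u: "u \<in> W1" and \<epsilon>: "0 < \<epsilon>"
  obtains \<delta> where "0 < \<delta>" and "\<And>w v. w \<in> W1 \<Longrightarrow> v \<in> W1 \<Longrightarrow> N (\<lambda>x. w x - u x) < \<delta> \<Longrightarrow>
      \<bar>log_operator \<Omega> p q \<mu> w v - log_operator \<Omega> p q \<mu> u v\<bar> \<le> \<epsilon> * N v"
proof -
  let ?a = "flux p q \<mu>"
  obtain \<delta> where \<delta>: "0 < \<delta>" and cont: "\<And>\<eta> \<zeta> :: 'a \<Rightarrow> 'a. finite_modular \<eta> \<Longrightarrow> finite_modular \<zeta> \<Longrightarrow>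
      modular_value \<eta> \<le> \<delta> \<Longrightarrow> modular_value \<zeta> \<le> 1 \<Longrightarrow>
      integrable (lebesgue_on \<Omega>) (\<lambda>x. norm (?a x (grad u x + \<eta> x) - ?a x (grad u x)) * norm (\<zeta> x)) \<and>
      (LINT x|lebesgue_on \<Omega>. norm (?a x (grad u x + \<eta> x) - ?a x (grad u x)) * norm (\<zeta> x)) \<le> \<epsilon>"
    using flux_continuity[OF W1D(3)[OF u] \<epsilon>] by blast
  show thesis
  proof (rule that)
    show "0 < min 1 \<delta>" using \<delta> by simp
    fix w v assume w: "w \<in> W1" and v: "v \<in> W1" and less: "N (\<lambda>x. w x - u x) < min 1 \<delta>"
    let ?\<eta> = "\<lambda>x. grad w x - grad u x"
    note [measurable] = W1D(4)[OF u] W1D(4)[OF w]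
    have AE_eta: "AE x in lebesgue_on \<Omega>. ?\<eta> x = grad (\<lambda>x. w x - u x) x"
      using grad_diff[OF w u] by eventually_elim simp
    have "?\<eta> \<in> borel_measurable (lebesgue_on \<Omega>)" by measurable
    note eta = finite_modular_cong_AE[OF W1D(3)[OF W1_diff[OF w u]] this AE_eta]
    obtain t where t: "0 < t" "t < min 1 \<delta>" "modular_value (\<lambda>x. (1 / t) *\<^sub>R grad (\<lambda>x. w x - u x) x) \<le> 1"
      using gauge_scale_below[OF W1_diff[OF w u] less] .
    then have small: "modular_value ?\<eta> \<le> \<delta>"
      using modular_value_le_scale[OF W1D(3)[OF W1_diff[OF w u]] t(1) _ t(3)] eta(2) by simp
    note iw = flux_pairing(3)[OF W1D(3)[OF w] W1D(3)[OF v]]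
    note iu = flux_pairing(3)[OF W1D(3)[OF u] W1D(3)[OF v]]
    let ?D = "\<lambda>x. (?a x (grad w x) - ?a x (grad u x)) \<bullet> grad v x"
    have D: "log_operator \<Omega> p q \<mu> w v - log_operator \<Omega> p q \<mu> u v = (LINT x|lebesgue_on \<Omega>. ?D x)"
      using u v w iu iw by (simp add: log_operator_eq inner_diff_left)
    have iD: "integrable (lebesgue_on \<Omega>) ?D"
      using Bochner_Integration.integrable_diff[OF iw iu] by (simp add: inner_diff_left)
    show "\<bar>log_operator \<Omega> p q \<mu> w v - log_operator \<Omega> p q \<mu> u v\<bar> \<le> \<epsilon> * N v"
      unfolding D
    proof (rule le_norm_if_le_scales[OF v, where d = "N v + 1"])
      fix s :: real assume s: "0 < s" "modular_value (\<lambda>x. (1 / s) *\<^sub>R grad v x) \<le> 1"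
      let ?d = "\<lambda>x. norm (?a x (grad w x) - ?a x (grad u x)) * norm ((1 / s) *\<^sub>R grad v x)"
      have d: "integrable (lebesgue_on \<Omega>) ?d" "(LINT x|lebesgue_on \<Omega>. ?d x) \<le> \<epsilon>"
        using cont[OF eta(1) finite_modular_scale[OF W1D(3)[OF v]] small s(2)] by auto
      have "\<bar>LINT x|lebesgue_on \<Omega>. ?D x\<bar> \<le> (LINT x|lebesgue_on \<Omega>. \<bar>?D x\<bar>)"
        by (rule integral_abs_bound)
      also have "\<dots> \<le> (LINT x|lebesgue_on \<Omega>. s * ?d x)"
      proof (rule integral_mono_AE)
        show "AE x in lebesgue_on \<Omega>. \<bar>?D x\<bar> \<le> s * ?d x"
          using s by (intro always_eventually allI order_trans[OF Cauchy_Schwarz_ineq2]) simp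
        show "integrable (lebesgue_on \<Omega>) (\<lambda>x. s * ?d x)" by (rule integrable_mult_right) (rule d(1))
      qed (use iD in auto)
      also have "\<dots> = s * (LINT x|lebesgue_on \<Omega>. ?d x)" by (rule integral_mult_right_zero)
      also have "\<dots> \<le> s * \<epsilon>" using d s by (intro mult_left_mono) auto
      finally show "\<bar>LINT x|lebesgue_on \<Omega>. ?D x\<bar> \<le> \<epsilon> * s" by (simp add: mult.commute)
    qed (use \<epsilon> in auto)
  qed
qed

lemma norm_zero_eq_0: "N (\<lambda>x. 0) = 0"
proof -
  have "s \<in> gauge_scales (\<lambda>x. 0)" if s: "0 < s" for s
  proof -
    have H0: "H_log p q \<mu> x 0 = 0" for x by (simp add: H_log_def)
    have "modular \<Omega> p q \<mu> (\<lambda>x. norm (grad (\<lambda>x. 0) x) / s) = (\<integral>\<^sup>+x. 0 \<partial>lebesgue_on \<Omega>)"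
      unfolding modular_def using grad_zero
      by (intro nn_integral_cong_AE) (auto elim!: eventually_mono simp: H0)
    then show ?thesis using s by (simp add: gauge_scales_def modular_def H0)
  qed
  then have "gauge_scales (\<lambda>x. 0) = {0<..}" by (auto simp: gauge_scales_def)
  then show ?thesis by (simp add: norm_eq_Inf_gauge)
qed

lemma zero_in_W10: "(\<lambda>x. 0) \<in> W10_Hlog \<Omega> p q \<mu>"
proof -
  have "(\<lambda>x. 0) \<in> test_functions \<Omega>"
    by (simp add: test_functions_def Ck_const)
  then show ?thesis
    using zero_in_W1 norm_zero_eq_0 by (auto simp: W10_Hlog_def intro!: bexI[of _ "\<lambda>x. 0"])
qed

lemma W10_subset_W1: "W10_Hlog \<Omega> p q \<mu> \<subseteq> W1"
  by (auto simp: W10_Hlog_def)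

text \<open>Passing from the bound for each \<open>v\<close> to the dual norm needs a member of the unit ball, because the supremum of the
empty set is unspecified; zero is one. The halved \<open>\<epsilon>\<close> makes the inequality strict after taking the supremum.\<close>

lemma energy_C1:
  assumes V: "V \<subseteq> W1" and zero: "(\<lambda>x. 0) \<in> V"
  shows "C1_with_derivative V N (energy \<Omega> p q \<mu>) (log_operator \<Omega> p q \<mu>)"
  unfolding C1_with_derivative_def
proof (intro conjI ballI allI impI)
  fix u assume "u \<in> V"
  then have u: "u \<in> W1" using V by auto
  show "frechet_derivative_at V N (energy \<Omega> p q \<mu>) u (log_operator \<Omega> p q \<mu> u)"
    by (rule energy_frechet_derivative[OF V u])
  fix \<epsilon> :: real assume "0 < \<epsilon>"
  then have "0 < \<epsilon> / 2" by simp
  obtain \<delta> where \<delta>: "0 < \<delta>" and cont: "\<And>w v. w \<in> W1 \<Longrightarrow> v \<in> W1 \<Longrightarrow> N (\<lambda>x. w x - u x) < \<delta> \<Longrightarrow>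
      \<bar>log_operator \<Omega> p q \<mu> w v - log_operator \<Omega> p q \<mu> u v\<bar> \<le> \<epsilon> / 2 * N v"
    using log_operator_continuous[OF u \<open>0 < \<epsilon> / 2\<close>] by blast
  show "\<exists>\<delta>>0. \<forall>w\<in>V. N (\<lambda>x. w x - u x) < \<delta> \<longrightarrow>
      dual_norm V N (\<lambda>v. log_operator \<Omega> p q \<mu> w v - log_operator \<Omega> p q \<mu> u v) < \<epsilon>"
  proof (intro exI[of _ \<delta>] conjI \<delta> ballI impI)
    fix w assume "w \<in> V" and less: "N (\<lambda>x. w x - u x) < \<delta>"
    then have w: "w \<in> W1" using V by auto
    have "dual_norm V N (\<lambda>v. log_operator \<Omega> p q \<mu> w v - log_operator \<Omega> p q \<mu> u v) \<le> \<epsilon> / 2"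
      unfolding dual_norm_def
    proof (rule cSup_least)
      show "{\<bar>log_operator \<Omega> p q \<mu> w v - log_operator \<Omega> p q \<mu> u v\<bar> |v. v \<in> V \<and> N v \<le> 1} \<noteq> {}"
        using zero norm_zero_eq_0 by auto
      fix y assume "y \<in> {\<bar>log_operator \<Omega> p q \<mu> w v - log_operator \<Omega> p q \<mu> u v\<bar> |v. v \<in> V \<and> N v \<le> 1}"
      then obtain v where v: "v \<in> V" "N v \<le> 1"
        and y: "y = \<bar>log_operator \<Omega> p q \<mu> w v - log_operator \<Omega> p q \<mu> u v\<bar>" by blast
      have "y \<le> \<epsilon> / 2 * N v" unfolding y using v V by (intro cont w less) auto
      also have "\<dots> \<le> \<epsilon> / 2" using v(2) \<open>0 < \<epsilon>\<close> by simp
      finally show "y \<le> \<epsilon> / 2" .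
    qed
    then show "dual_norm V N (\<lambda>v. log_operator \<Omega> p q \<mu> w v - log_operator \<Omega> p q \<mu> u v) < \<epsilon>"
      using \<open>0 < \<epsilon>\<close> by simp
  qed
qed

end

text \<open>Compactness of the closure turns continuity of the exponents into the uniform bounds \<open>\<sigma> = inf p\<close> and \<open>q \<le> K\<close>; they
bound both exponents since \<open>p \<le> q\<close>.\<close>

lemma log_sobolev_if_C_plus:
  fixes \<Omega> :: "'a::euclidean_space set"
  assumes \<Omega>: "open \<Omega>" "bounded \<Omega>" "\<Omega> \<noteq> {}"
    and p: "p \<in> C_plus \<Omega>" and q: "q \<in> C_plus \<Omega>"
    and pq: "\<And>x. x \<in> closure \<Omega> \<Longrightarrow> p x \<le> q x"
    and \<mu>: "\<mu> \<in> borel_measurable (lebesgue_on \<Omega>)" "AE x in lebesgue_on \<Omega>. 0 \<le> \<mu> x"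
  obtains \<sigma> K where "log_sobolev \<Omega> p q \<mu> \<sigma> K"
proof -
  have cpt: "compact (closure \<Omega>)" using \<Omega> by simp
  have cont: "continuous_on (closure \<Omega>) p" "continuous_on (closure \<Omega>) q"
    using p q by (auto simp: C_plus_def)
  have bounded: "bounded (p ` closure \<Omega>)" "bounded (q ` closure \<Omega>)"
    using cont cpt by (auto intro!: compact_imp_bounded compact_continuous_image)
  have \<sigma>: "(INF x\<in>closure \<Omega>. p x) \<le> p x" if "x \<in> closure \<Omega>" for x
    using bounded(1) that by (intro cINF_lower bounded_imp_bdd_below)
  obtain K where K: "1 < K" "\<And>x. x \<in> closure \<Omega> \<Longrightarrow> q x \<le> K"
  proof -
    obtain B where "\<And>x. x \<in> closure \<Omega> \<Longrightarrow> q x \<le> B"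
      using bounded_imp_bdd_above[OF bounded(2)] by (auto simp: bdd_above_def)
    then show thesis using that[of "max 2 B"] by (force simp: le_max_iff_disj)
  qed
  have sub: "\<Omega> \<subseteq> closure \<Omega>" by (rule closure_subset)
  have "log_sobolev \<Omega> p q \<mu> (INF x\<in>closure \<Omega>. p x) K"
  proof
    show "p \<in> borel_measurable (lebesgue_on \<Omega>)" "q \<in> borel_measurable (lebesgue_on \<Omega>)"
      using cont \<Omega>(1) by (auto intro!: continuous_imp_measurable_on_sets_lebesgue continuous_on_subset[OF _ sub])
    show "1 < (INF x\<in>closure \<Omega>. p x)" using p by (simp add: C_plus_def)
    show "AE x in lebesgue_on \<Omega>. growth_at p q \<mu> x (INF x\<in>closure \<Omega>. p x) K"
      using \<mu>(2) AE_space
    proof eventually_elim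
      case (elim x)
      then have "x \<in> closure \<Omega>" using sub by auto
      then show ?case
        using elim p \<sigma> K pq by (simp add: growth_at_def C_plus_def)
    qed
  qed (use \<Omega> \<mu> K in auto)
  then show thesis by (rule that)
qed

theorem theorem4p1:
  fixes \<Omega> :: "'a::euclidean_space set" and p q \<mu> :: "'a \<Rightarrow> real"
  assumes "DIM('a) \<ge> 2"
    and "bounded_lipschitz_domain \<Omega>"
    and "p \<in> C_plus \<Omega>" and "q \<in> C_plus \<Omega>"
    and "\<And>x. x \<in> closure \<Omega> \<Longrightarrow> p x \<le> q x"
    and "integrable (lebesgue_on \<Omega>) \<mu>"
    and "AE x in lebesgue_on \<Omega>. 0 \<le> \<mu> x"
  shows "(\<forall>u\<in>W10_Hlog \<Omega> p q \<mu>.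
            integrable (lebesgue_on \<Omega>) (\<lambda>x. energy_density p q \<mu> x (weak_gradient \<Omega> u x))) \<and>
         (\<forall>u\<in>W10_Hlog \<Omega> p q \<mu>. \<forall>v\<in>W10_Hlog \<Omega> p q \<mu>.
            integrable (lebesgue_on \<Omega>)
              (\<lambda>x. p_flux p x (weak_gradient \<Omega> u x) \<bullet> weak_gradient \<Omega> v x) \<and>
            integrable (lebesgue_on \<Omega>)
              (\<lambda>x. q_log_flux q \<mu> x (weak_gradient \<Omega> u x) \<bullet> weak_gradient \<Omega> v x)) \<and>
         (\<forall>u\<in>W10_Hlog \<Omega> p q \<mu>.
            log_operator \<Omega> p q \<mu> u \<in> dual_space (W10_Hlog \<Omega> p q \<mu>) (norm_W1 \<Omega> p q \<mu>)) \<and>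
         C1_with_derivative (W10_Hlog \<Omega> p q \<mu>) (norm_W1 \<Omega> p q \<mu>)
           (energy \<Omega> p q \<mu>) (log_operator \<Omega> p q \<mu>)"
proof -
  have "open \<Omega>" "bounded \<Omega>" "\<Omega> \<noteq> {}"
    using assms(2) by (auto simp: bounded_lipschitz_domain_def)
  then obtain \<sigma> K where "log_sobolev \<Omega> p q \<mu> \<sigma> K"
    using log_sobolev_if_C_plus[OF _ _ _ assms(3,4,5) borel_measurable_integrable[OF assms(6)] assms(7)] by metis
  then interpret log_sobolev \<Omega> p q \<mu> \<sigma> K .
  note in_W1 = subsetD[OF W10_subset_W1]
  show ?thesis
    by (intro conjI ballI integrable_energy_density flux_pairing(1,2) W1D(3) in_W1
        log_operator_in_dual[OF W10_subset_W1] energy_C1[OF W10_subset_W1 zero_in_W10])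
qed

end
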